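(* Suppose the ellipticity assumption holds on $U$ and $|b(x)|\le M_2$ for all $x\in U$ with a constant $M_2\ge0$. There exist constants $C_*>0$, $\nu>0$ and $K_1>0$, independent of $u$ and $f$, such that the following holds. Let $f:U\to\mathbb R$ be bounded, and let $u\in C^2(U)\cap C(\widetilde U)$ be bounded on $\gamma$ and below exponential growth in $\widetilde U$, with $Lu=f$ in $U$. Then, for any $\theta\ge\theta_0$, $$\max_{x\in \mathcal S_\theta} |u(x)|\le M_B+K_1 M_f + C_*\Big( \max_{x\in \mathcal S_{\theta_0}}|u(x)|+M_B+K_1 M_f \Big)e^{-\nu(\theta-\theta_0)}.$$ Consequently, $$\limsup_{\theta\to\infty}\Big(\max_{x\in \mathcal S_\theta}|u(x)|\Big)\le \limsup_{\theta\to\infty}M_B(\theta)+K_1 \limsup_{\theta\to\infty}M_f(\theta).$$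
   Context: Domain. Let $X(r,\theta)=(r\cos\theta,r\sin\theta)$ for $r\ge0$, $\theta\in\mathbb R$. Fix $\theta_0\in\mathbb R$ and positive continuous functions $r_1,r_2$ on $[\theta_0,\infty)$ with $r_2(\theta+2\pi)<r_1(\theta)<r_2(\theta)$ for all $\theta\ge\theta_0$, and assume there is $r_*>0$ with $\lim_{\theta\to\infty}r_1(\theta)=\lim_{\theta\to\infty}r_2(\theta)=r_*$. Define $U=\{X(r,\theta):\theta>\theta_0,\ r_1(\theta)<r<r_2(\theta)\}$ (open and bounded), $\widetilde U=\{X(r,\theta):\theta\ge\theta_0,\ r_1(\theta)\le r\le r_2(\theta)\}$, $\gamma=\{X(r_i(\theta),\theta):\theta\ge\theta_0,\ i=1,2\}$, and $\mathcal S_\theta=\{X(r,\theta): r_1(\theta)\le r\le r_2(\theta)\}$ for $\theta\ge\theta_0$. Operator. $A=(a_{ij})$ is a function from $U$ to the real symmetric $2\times2$ matrices, $b:U\to\mathbb R^2$, and $Lu=-\sum_{i,j=1}^2 a_{ij}\frac{\partial^2u}{\partial x_i\partial x_j}+b\cdot\nabla u$ for $u\in C^2(U)$. Ellipticity assumption on $U$: there are constants $c_0>0$, $M_1>0$ such that $\xi^{\rm T}A(x)\xi\ge c_0|\xi|^2$ and $\mathrm{Tr}(A(x))\le M_1$ for all $x\in U$, $\xi\in\mathbb R^2$. A function $u:\widetilde U\to\mathbb R$ is below exponential growth in $\widetilde U$ if for any $\varepsilon>0$, $\lim_{\theta\to\infty}\big(e^{-\varepsilon\theta}\sup_{x\in\mathcal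 S_\theta}|u(x)|\big)=0$. Notation: $M_B=\sup_{x\in\gamma}|u(x)|$, $M_f=\sup_{x\in U}|f(x)|$, $M_B(\theta)=\max\{|u(x)|:x\in\gamma\cap\mathcal S_\theta\}$, $M_f(\theta)=\sup\{|f(x)|:x\in U\cap\mathcal S_\theta\}$. *)

theory Defs
  imports "HOL-Analysis.Analysis"
begin

definition polar :: "real \<Rightarrow> real \<Rightarrow> real^2" where
  "polar r \<theta> = vector [r * cos \<theta>, r * sin \<theta>]"

definition spiral_interior :: "real \<Rightarrow> (real \<Rightarrow> real) \<Rightarrow> (real \<Rightarrow> real) \<Rightarrow> (real^2) set" where
  "spiral_interior \<theta>\<^sub>0 r\<^sub>1 r\<^sub>2 = {polar r \<theta> | r \<theta>. \<theta>\<^sub>0 < \<theta> \<and> r\<^sub>1 \<theta> < r \<and> r < r\<^sub>2 \<theta>}"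

text \<open>The set \<open>U\<close> with a tilde. It contains the initial cross-section, but not the limit circle
  \<open>r = r\<^sub>*\<close>, so it is not closed.\<close>

definition spiral_full :: "real \<Rightarrow> (real \<Rightarrow> real) \<Rightarrow> (real \<Rightarrow> real) \<Rightarrow> (real^2) set" where
  "spiral_full \<theta>\<^sub>0 r\<^sub>1 r\<^sub>2 = {polar r \<theta> | r \<theta>. \<theta>\<^sub>0 \<le> \<theta> \<and> r\<^sub>1 \<theta> \<le> r \<and> r \<le> r\<^sub>2 \<theta>}"

text \<open>The set \<open>\<gamma>\<close>: the two bounding curves only, without the interior of the initial
  cross-section.\<close>

definition spiral_curves :: "real \<Rightarrow> (real \<Rightarrow> real) \<Rightarrow> (real \<Rightarrow> real) \<Rightarrow> (real^2) set" where
  "spiral_curves \<theta>\<^sub>0 r\<^sub>1 r\<^sub>2 =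
    {polar (r\<^sub>1 \<theta>) \<theta> | \<theta>. \<theta>\<^sub>0 \<le> \<theta>} \<union> {polar (r\<^sub>2 \<theta>) \<theta> | \<theta>. \<theta>\<^sub>0 \<le> \<theta>}"

definition cross_section :: "(real \<Rightarrow> real) \<Rightarrow> (real \<Rightarrow> real) \<Rightarrow> real \<Rightarrow> (real^2) set" where
  "cross_section r\<^sub>1 r\<^sub>2 \<theta> = {polar r \<theta> | r. r\<^sub>1 \<theta> \<le> r \<and> r \<le> r\<^sub>2 \<theta>}"

definition partial_deriv :: "'n \<Rightarrow> (real^'n \<Rightarrow> real) \<Rightarrow> real^'n \<Rightarrow> real" where
  "partial_deriv i g x = frechet_derivative g (at x) (axis i 1)"

text \<open>The next two notions are meant for open sets only: derivatives are taken at \<open>x\<close>, not within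
  \<open>S\<close>.\<close>

definition C1_on :: "(real^'n) set \<Rightarrow> (real^'n \<Rightarrow> real) \<Rightarrow> bool" where
  "C1_on S g \<longleftrightarrow> (\<forall>x\<in>S. g differentiable (at x)) \<and> (\<forall>i. continuous_on S (partial_deriv i g))"

definition C2_on :: "(real^'n) set \<Rightarrow> (real^'n \<Rightarrow> real) \<Rightarrow> bool" where
  "C2_on S g \<longleftrightarrow> C1_on S g \<and> (\<forall>i. C1_on S (partial_deriv i g))"

definition nondiv_op ::
    "(real^2 \<Rightarrow> real^2^2) \<Rightarrow> (real^2 \<Rightarrow> real^2) \<Rightarrow> (real^2 \<Rightarrow> real) \<Rightarrow> real^2 \<Rightarrow> real" where
  "nondiv_op A b u x =
    - (\<Sum>i\<in>UNIV. \<Sum>j\<in>UNIV. A x $ i $ j * partial_deriv i (partial_deriv j u) x)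
    + b x \<bullet> (\<chi> i. partial_deriv i u x)"

text \<open>The supremum is taken in the extended reals, so that a function that is unbounded on
  cross-sections is not covered by accident.\<close>

definition below_exp_growth :: "(real \<Rightarrow> real) \<Rightarrow> (real \<Rightarrow> real) \<Rightarrow> (real^2 \<Rightarrow> real) \<Rightarrow> bool" where
  "below_exp_growth r\<^sub>1 r\<^sub>2 u \<longleftrightarrow>
    (\<forall>\<epsilon>>0. ((\<lambda>\<theta>. ereal (exp (- \<epsilon> * \<theta>)) * (SUP x\<in>cross_section r\<^sub>1 r\<^sub>2 \<theta>. ereal \<bar>u x\<bar>))
              \<longlongrightarrow> 0) at_top)"

text \<open>A supremum in the reals, meaningful only for \<open>g\<close> bounded on a nonempty \<open>S\<close>. It also renders
  the maxima over cross-sections, which are attained since cross-sections are compact and \<open>u\<close> is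
  continuous on them.\<close>

definition sup_abs :: "(real^2 \<Rightarrow> real) \<Rightarrow> (real^2) set \<Rightarrow> real" where
  "sup_abs g S = (SUP x\<in>S. \<bar>g x\<bar>)"

end

theory Submission
  imports Defs
begin

text \<open>The estimate comes from the maximum principle applied to one explicit barrier. On the spiral the
  polar angle \<open>\<theta>\<close> is a single-valued smooth function, because consecutive turns are disjoint, and its
  first and second derivatives are bounded, because the radius stays above \<open>r_star\<close>. The classical
  supersolution of a nondivergence operator on a bounded set is \<open>K - exp (\<mu> x\<^sub>1)\<close>: for \<open>\<mu>\<close> large,
  ellipticity lets the second-order term win against the drift, and \<open>L (K - exp (\<mu> x\<^sub>1))\<close> is bounded
  below by a positive constant. Multiplying it by \<open>exp (s \<theta>)\<close> perturbs this by \<open>O(s)\<close>, so for all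
  \<open>\<bar>s\<bar> \<le> \<nu>\<close> with \<open>\<nu>\<close> small
    \<open>G\<^sub>s = (K - exp (\<mu> x\<^sub>1)) exp (s \<theta>)\<close>  satisfies  \<open>L G\<^sub>s \<ge> \<kappa> exp (s \<theta>)\<close>
  (\<open>barrier_supersolution\<close>).

  Three values of \<open>s\<close> serve three purposes. Let \<open>m\<^sub>B\<close>, \<open>m\<^sub>f\<close>, \<open>m\<^sub>T\<close> bound \<open>\<bar>u\<bar>\<close> on the two sides, \<open>\<bar>f\<bar>\<close>
  inside, and \<open>\<bar>u\<bar>\<close> on the initial slice \<open>\<theta> = T\<close>, and consider
    \<open>W = m\<^sub>B + (m\<^sub>f / \<kappa>) G\<^sub>0 + m\<^sub>T exp (\<nu> T) G\<^sub>-\<^sub>\<nu> + \<epsilon> G\<^sub>\<nu>\<close>.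
  The term with \<open>s = 0\<close> pays for the source, the decaying one for the initial slice, and the growing
  one dominates \<open>u\<close> far out, since \<open>u\<close> grows more slowly than any exponential. So \<open>\<plusminus>u \<le> W\<close> on the
  boundary of a long truncated spiral, and \<open>L W > m\<^sub>f\<close> forbids an interior positive maximum of
  \<open>\<plusminus>u - W\<close> (\<open>strict_comparison\<close>). Letting \<open>\<epsilon> \<rightarrow> 0\<close> gives \<open>comparison\<close> and \<open>slice_estimate\<close>, whose
  constants do not depend on the starting angle \<open>T\<close>. With \<open>T = \<theta>\<^sub>0\<close> this is the exponential estimate;
  letting \<open>T \<rightarrow> \<infinity>\<close>, where \<open>m\<^sub>B\<close> and \<open>m\<^sub>f\<close> can be taken arbitrarily close to the upper limits of the
  data, gives the asymptotic one.

  All differentiation takes place along straight lines through a maximum point. A positive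
  semidefinite \<open>A\<close> is \<open>\<xi> \<xi>\<^sup>T + \<eta> \<eta>\<^sup>T\<close>, so \<open>L\<close> at a point involves only the second derivatives in the
  directions \<open>\<xi>\<close> and \<open>\<eta>\<close> and the first derivative in the direction of the drift, and the
  one-variable second-derivative test suffices.\<close>

section \<open>The maximum principle along lines\<close>

text \<open>If the second derivative were positive at \<open>0\<close>, the first one would be positive just to the right
  of \<open>0\<close>, and \<open>h\<close> would increase beyond its maximum. The derivative \<open>h'\<close> is differentiated at the
  single point \<open>0\<close>, which is what the differentiability of the partial derivatives of a \<open>C\<^sup>2\<close> function
  provides.\<close>

lemma local_max_real_derivatives:
  fixes h h' :: "real \<Rightarrow> real"
  assumes "\<forall>\<^sub>F t in nhds 0. h t \<le> h 0"
    and "\<forall>\<^sub>F t in nhds 0. (h has_real_derivative h' t) (at t)"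
    and d: "(h' has_real_derivative d) (at 0)"
  shows "h' 0 = 0" and "d \<le> 0"
proof -
  have "\<forall>\<^sub>F t in nhds 0. h t \<le> h 0 \<and> (h has_real_derivative h' t) (at t)"
    using assms(1,2) by (rule eventually_conj)
  then obtain e where e: "e > 0"
      "\<And>t. \<bar>t\<bar> < e \<Longrightarrow> h t \<le> h 0 \<and> (h has_real_derivative h' t) (at t)"
    by (auto simp: eventually_nhds_metric dist_real_def)
  show h0: "h' 0 = 0"
    by (rule DERIV_local_max[of h "h' 0" 0 e]) (use e in auto)
  show "d \<le> 0"
  proof (rule ccontr)
    assume "\<not> d \<le> 0"
    then obtain k where k: "k > 0" "\<And>t. t > 0 \<Longrightarrow> t < k \<Longrightarrow> h' t > 0"
      using DERIV_pos_inc_right[OF d] h0 by auto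
    define t where "t = min e k / 2"
    have t: "0 < t" "t < e" "t < k" using e(1) k(1) by (auto simp: t_def)
    have "h 0 < h t"
    proof (rule DERIV_pos_imp_increasing_open[OF t(1)])
      fix z assume z: "0 < z" "z < t"
      then show "\<exists>y. (h has_real_derivative y) (at z) \<and> 0 < y"
        using e(2)[of z] k(2)[of z] t by auto
    next
      show "continuous_on {0..t} h"
      proof (rule DERIV_continuous_on)
        fix z assume "z \<in> {0..t}"
        then have "\<bar>z\<bar> < e" using t by auto
        then show "(h has_real_derivative h' z) (at z within {0..t})"
          using e(2) has_field_derivative_at_within by blast
      qed
    qed
    then show False using e(2)[of t] t by auto
  qed
qed

lemma has_real_derivative_along_line:
  fixes g :: "real^'n \<Rightarrow> real"
  assumes "g differentiable (at (x + t *\<^sub>R v))"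
  shows "((\<lambda>t. g (x + t *\<^sub>R v)) has_real_derivative
           (\<Sum>i\<in>UNIV. v $ i * partial_deriv i g (x + t *\<^sub>R v))) (at t)"
proof -
  let ?D = "frechet_derivative g (at (x + t *\<^sub>R v))"
  have D: "(g has_derivative ?D) (at (x + t *\<^sub>R v))"
    using assms frechet_derivative_works by blast
  then have lin: "linear ?D" using has_derivative_linear by blast
  have l: "((\<lambda>t. x + t *\<^sub>R v) has_derivative (\<lambda>h. h *\<^sub>R v)) (at t)"
    by (auto intro!: derivative_eq_intros)
  have "((\<lambda>t. g (x + t *\<^sub>R v)) has_derivative (\<lambda>h. ?D (h *\<^sub>R v))) (at t)"
    using diff_chain_at[OF l D] by (simp add: o_def)
  moreover have "?D (h *\<^sub>R v) = (\<Sum>i\<in>UNIV. v $ i * partial_deriv i g (x + t *\<^sub>R v)) * h" for h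
  proof -
    have "?D v = ?D (\<Sum>i\<in>UNIV. v $ i *\<^sub>R axis i 1)"
      using basis_expansion[of v] by (simp add: scalar_mult_eq_scaleR)
    also have "\<dots> = (\<Sum>i\<in>UNIV. v $ i * ?D (axis i 1))"
      using lin by (simp add: linear_sum linear_scale)
    finally show ?thesis
      using lin by (simp add: linear_scale partial_deriv_def)
  qed
  ultimately show ?thesis by (simp add: has_field_derivative_def)
qed

text \<open>A Cholesky factorization: completing the square in the first variable leaves the determinant
  divided by the upper left entry, which is nonnegative. The bound on \<open>\<xi>\<^sub>1\<^sup>2 + \<eta>\<^sub>1\<^sup>2\<close>, which is that
  entry, is how ellipticity acts on a barrier that depends on \<open>x\<^sub>1\<close>.\<close>

lemma symmetric_matrix_2_as_sum_of_squares:
  fixes A :: "real^2^2"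
  assumes sym: "transpose A = A" and "c > 0"
    and ell: "\<And>\<xi>. \<xi> \<bullet> (A *v \<xi>) \<ge> c * (norm \<xi>)\<^sup>2"
  obtains \<xi> \<eta> :: "real^2"
  where "\<And>i j. A $ i $ j = \<xi> $ i * \<xi> $ j + \<eta> $ i * \<eta> $ j"
    and "(\<xi> $ 1)\<^sup>2 + (\<eta> $ 1)\<^sup>2 \<ge> c" and "(norm \<xi>)\<^sup>2 + (norm \<eta>)\<^sup>2 = trace A"
proof -
  define p q w where "p = A $ 1 $ 1" and "q = A $ 1 $ 2" and "w = A $ 2 $ 2"
  have q': "A $ 2 $ 1 = q"
  proof -
    have "A $ 2 $ 1 = transpose A $ 1 $ 2" by (simp add: transpose_def)
    then show ?thesis by (simp only: sym q_def)
  qed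
  have form: "c * (x\<^sup>2 + y\<^sup>2) \<le> p * x\<^sup>2 + 2 * q * x * y + w * y\<^sup>2" for x y
  proof -
    let ?v = "vector [x, y] :: real^2"
    have "?v \<bullet> (A *v ?v) = x * (p * x + q * y) + y * (q * x + w * y)"
      by (simp add: inner_vec_def sum_2 matrix_vector_mult_def q' flip: p_def q_def w_def)
    also have "\<dots> = p * x\<^sup>2 + 2 * q * x * y + w * y\<^sup>2" by algebra
    finally show ?thesis
      using ell[of ?v] by (simp add: norm_vec_def L2_set_def sum_2)
  qed
  have p: "p \<ge> c" using form[of 1 0] by simp
  then have p0: "p > 0" using \<open>c > 0\<close> by simp
  \<comment> \<open>Evaluating the quadratic form at \<open>(- q, p)\<close> produces \<open>p\<close> times the determinant.\<close>
  have "0 \<le> c * ((-q)\<^sup>2 + p\<^sup>2)" using \<open>c > 0\<close> by simp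
  also have "\<dots> \<le> p * (p * w - q\<^sup>2)"
    using form[of "-q" p] by (simp add: algebra_simps power2_eq_square)
  finally have det: "0 \<le> p * w - q\<^sup>2" using p0 by (simp add: zero_le_mult_iff)
  define \<xi> \<eta> :: "real^2"
    where "\<xi> = vector [sqrt p, q / sqrt p]" and "\<eta> = vector [0, sqrt ((p * w - q\<^sup>2) / p)]"
  have co: "\<xi> $ 1 = sqrt p" "\<xi> $ 2 = q / sqrt p" "\<eta> $ 1 = 0" "\<eta> $ 2 = sqrt ((p * w - q\<^sup>2) / p)"
    by (auto simp: \<xi>_def \<eta>_def)
  have sq: "sqrt p * sqrt p = p" "sqrt ((p * w - q\<^sup>2) / p) * sqrt ((p * w - q\<^sup>2) / p) = (p * w - q\<^sup>2) / p"
    using p0 det by (simp_all only: real_sqrt_mult_self abs_of_nonneg divide_nonneg_pos less_imp_le)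
  have w: "w = q / sqrt p * (q / sqrt p) + (p * w - q\<^sup>2) / p"
    using p0 by (simp add: diff_divide_distrib power2_eq_square)
  have ent: "A $ i $ j = \<xi> $ i * \<xi> $ j + \<eta> $ i * \<eta> $ j" for i j
  proof -
    have "A $ 1 $ 1 = \<xi> $ 1 * \<xi> $ 1 + \<eta> $ 1 * \<eta> $ 1" by (simp only: co sq p_def[symmetric])
    moreover have "A $ 1 $ 2 = \<xi> $ 1 * \<xi> $ 2 + \<eta> $ 1 * \<eta> $ 2"
      using p0 by (simp add: co flip: q_def)
    moreover have "A $ 2 $ 1 = \<xi> $ 2 * \<xi> $ 1 + \<eta> $ 2 * \<eta> $ 1"
      using p0 by (simp add: co q')
    moreover have "A $ 2 $ 2 = \<xi> $ 2 * \<xi> $ 2 + \<eta> $ 2 * \<eta> $ 2"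
      using w by (simp only: co sq w_def[symmetric])
    ultimately show ?thesis using exhaust_2[of i] exhaust_2[of j] by auto
  qed
  show thesis
  proof
    show "A $ i $ j = \<xi> $ i * \<xi> $ j + \<eta> $ i * \<eta> $ j" for i j by (rule ent)
    show "(\<xi> $ 1)\<^sup>2 + (\<eta> $ 1)\<^sup>2 \<ge> c" using p p0 by (simp add: co)
    show "(norm \<xi>)\<^sup>2 + (norm \<eta>)\<^sup>2 = trace A"
      by (simp add: trace_def sum_2 ent norm_vec_def L2_set_def power2_eq_square)
  qed
qed

text \<open>The maximum principle at one point. The competitor enters only through its restrictions \<open>\<phi> v\<close> to
  the lines \<open>x + t v\<close>, so it may be given in coordinates adapted to \<open>x\<close>, such as a local branch of the
  polar angle. At the maximum the gradients of \<open>\<sigma> u\<close> and of the competitor agree, which settles the drift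
  term, and the second derivatives along \<open>\<xi>\<close> and \<open>\<eta>\<close>, whose sum is minus the second-order part
  of the operator, compare by the second-derivative test. The factor \<open>\<sigma>\<close> will be \<open>\<plusminus>1\<close> and gives both bounds
  on \<open>u\<close> at once.\<close>

lemma touching_point_inequality:
  fixes u :: "real^2 \<Rightarrow> real" and \<phi> \<phi>' :: "real^2 \<Rightarrow> real \<Rightarrow> real"
  assumes C2: "C2_on S u"
    and S: "\<And>v. \<forall>\<^sub>F t in nhds 0. x + t *\<^sub>R v \<in> S"
    and A: "\<And>i j. A x $ i $ j = \<xi> $ i * \<xi> $ j + \<eta> $ i * \<eta> $ j"
    and \<phi>: "\<And>v. \<forall>\<^sub>F t in nhds 0. (\<phi> v has_real_derivative \<phi>' v t) (at t)"
    and \<phi>': "\<And>v. (\<phi>' v has_real_derivative \<phi>'' v) (at 0)"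
    and max: "\<And>v. \<forall>\<^sub>F t in nhds 0. \<sigma> * u (x + t *\<^sub>R v) - \<phi> v t \<le> \<sigma> * u x - \<phi> v 0"
  shows "- (\<phi>'' \<xi> + \<phi>'' \<eta>) + \<phi>' (b x) 0 \<le> \<sigma> * nondiv_op A b u x"
proof -
  define G where "G v t = (\<Sum>i\<in>UNIV. v $ i * partial_deriv i u (x + t *\<^sub>R v))" for v t
  define H where "H v = (\<Sum>i\<in>UNIV. v $ i * (\<Sum>j\<in>UNIV. v $ j * partial_deriv j (partial_deriv i u) x))" for v :: "real^2"
  have xS: "x \<in> S" using eventually_nhds_x_imp_x[OF S[of 0]] by simp
  have "\<forall>\<^sub>F t in nhds 0. ((\<lambda>t. u (x + t *\<^sub>R v)) has_real_derivative G v t) (at t)" for v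
    using S[of v] C2 unfolding G_def C2_on_def C1_on_def
    by (auto elim!: eventually_mono intro!: has_real_derivative_along_line)
  then have d1: "\<forall>\<^sub>F t in nhds 0. ((\<lambda>t. \<sigma> * u (x + t *\<^sub>R v) - \<phi> v t) has_real_derivative
      \<sigma> * G v t - \<phi>' v t) (at t)" for v
    using \<phi>[of v] by eventually_elim (intro DERIV_diff DERIV_cmult)
  have "(G v has_real_derivative H v) (at 0)" for v
  proof -
    have "((\<lambda>t. partial_deriv i u (x + t *\<^sub>R v)) has_real_derivative
        (\<Sum>j\<in>UNIV. v $ j * partial_deriv j (partial_deriv i u) (x + 0 *\<^sub>R v))) (at 0)" for i
      using C2 xS by (intro has_real_derivative_along_line) (auto simp: C2_on_def C1_on_def)
    then show ?thesis
      unfolding G_def[abs_def] H_def by (intro DERIV_sum DERIV_cmult) simp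
  qed
  then have d2: "((\<lambda>t. \<sigma> * G v t - \<phi>' v t) has_real_derivative \<sigma> * H v - \<phi>'' v) (at 0)" for v
    using \<phi>'[of v] by (intro DERIV_diff DERIV_cmult)
  have max': "\<forall>\<^sub>F t in nhds 0. \<sigma> * u (x + t *\<^sub>R v) - \<phi> v t \<le> \<sigma> * u (x + 0 *\<^sub>R v) - \<phi> v 0" for v
    using max[of v] by simp
  note D = local_max_real_derivatives[OF max' d1 d2]
  have op: "nondiv_op A b u x = - (H \<xi> + H \<eta>) + G (b x) 0"
    by (simp add: nondiv_op_def H_def G_def A sum_2 inner_vec_def algebra_simps)
  have "\<sigma> * nondiv_op A b u x = - (\<sigma> * H \<xi> + \<sigma> * H \<eta>) + \<sigma> * G (b x) 0"
    unfolding op by algebra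
  then show ?thesis using D(1)[of "b x"] D(2)[of \<xi>] D(2)[of \<eta>] by simp
qed

section \<open>The polar angle along a line\<close>

lemma polar_components [simp]: "polar r \<theta> $ 1 = r * cos \<theta>" "polar r \<theta> $ 2 = r * sin \<theta>"
  by (simp_all add: polar_def)

text \<open>The components of a vector in the orthonormal frame \<open>(cos \<theta>, sin \<theta>)\<close>, \<open>(- sin \<theta>, cos \<theta>)\<close>.\<close>

definition angular :: "real \<Rightarrow> real^2 \<Rightarrow> real" where
  "angular \<theta> v = v $ 2 * cos \<theta> - v $ 1 * sin \<theta>"

definition radial :: "real \<Rightarrow> real^2 \<Rightarrow> real" where
  "radial \<theta> v = v $ 1 * cos \<theta> + v $ 2 * sin \<theta>"

lemma angular_radial_norm: "(angular \<theta> v)\<^sup>2 + (radial \<theta> v)\<^sup>2 = (norm v)\<^sup>2"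
proof -
  have "(angular \<theta> v)\<^sup>2 + (radial \<theta> v)\<^sup>2 = ((v $ 1)\<^sup>2 + (v $ 2)\<^sup>2) * ((sin \<theta>)\<^sup>2 + (cos \<theta>)\<^sup>2)"
    unfolding angular_def radial_def by algebra
  also have "\<dots> = (norm v)\<^sup>2"
    by (simp add: norm_vec_def L2_set_def sum_2)
  finally show ?thesis .
qed

lemma abs_angular_le_norm: "\<bar>angular \<theta> v\<bar> \<le> norm v"
proof (rule power2_le_imp_le)
  show "\<bar>angular \<theta> v\<bar>\<^sup>2 \<le> (norm v)\<^sup>2"
    unfolding angular_radial_norm[of \<theta> v, symmetric] by simp
qed simp

text \<open>Polar coordinates of the point \<open>polar r \<theta> + t v\<close>. In the frame at angle \<open>\<theta>\<close> this point is
  \<open>(r + t radial, t angular)\<close>, so the increment of the angle is an arctangent, and the branch of the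
  angle with value \<open>\<theta>\<close> at \<open>t = 0\<close> is selected for any real \<open>\<theta>\<close>.\<close>

definition line_radius :: "real \<Rightarrow> real \<Rightarrow> real^2 \<Rightarrow> real \<Rightarrow> real" where
  "line_radius r \<theta> v t = sqrt ((r + t * radial \<theta> v)\<^sup>2 + (t * angular \<theta> v)\<^sup>2)"

definition line_angle :: "real \<Rightarrow> real \<Rightarrow> real^2 \<Rightarrow> real \<Rightarrow> real" where
  "line_angle r \<theta> v t = \<theta> + arctan (t * angular \<theta> v / (r + t * radial \<theta> v))"

lemma line_polar_0: "r > 0 \<Longrightarrow> line_radius r \<theta> v 0 = r" "line_angle r \<theta> v 0 = \<theta>"
  by (simp_all add: line_radius_def line_angle_def)

lemma line_eq_polar:
  assumes "r + t * radial \<theta> v > 0"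
  shows "polar r \<theta> + t *\<^sub>R v = polar (line_radius r \<theta> v t) (line_angle r \<theta> v t)"
proof -
  define D N where "D = r + t * radial \<theta> v" and "N = t * angular \<theta> v"
  have D: "D > 0" using assms by (simp add: D_def)
  have "sqrt (D\<^sup>2 + N\<^sup>2) = sqrt (D\<^sup>2 * (1 + (N / D)\<^sup>2))"
    using D by (simp add: field_simps)
  also have "\<dots> = D * sqrt (1 + (N / D)\<^sup>2)" using D by (simp add: real_sqrt_mult)
  finally have sq: "sqrt (D\<^sup>2 + N\<^sup>2) = D * sqrt (1 + (N / D)\<^sup>2)" .
  have "sqrt (1 + (N / D)\<^sup>2) > 0" by (simp add: add_pos_nonneg)
  then have c: "sqrt (D\<^sup>2 + N\<^sup>2) * cos (arctan (N / D)) = D"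
    and s: "sqrt (D\<^sup>2 + N\<^sup>2) * sin (arctan (N / D)) = N"
    using D by (simp_all add: sq cos_arctan sin_arctan)
  have cs: "(cos \<theta>)\<^sup>2 = 1 - (sin \<theta>)\<^sup>2" using sin_cos_squared_add[of \<theta>] by algebra
  have 1: "r * cos \<theta> + t * v $ 1 = D * cos \<theta> - N * sin \<theta>"
    using cs unfolding D_def N_def radial_def angular_def by algebra
  have 2: "r * sin \<theta> + t * v $ 2 = D * sin \<theta> + N * cos \<theta>"
    using cs unfolding D_def N_def radial_def angular_def by algebra
  have "sqrt (D\<^sup>2 + N\<^sup>2) * cos (\<theta> + arctan (N / D)) = D * cos \<theta> - N * sin \<theta>"
  proof -
    have "sqrt (D\<^sup>2 + N\<^sup>2) * cos (\<theta> + arctan (N / D))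
        = (sqrt (D\<^sup>2 + N\<^sup>2) * cos (arctan (N / D))) * cos \<theta>
          - (sqrt (D\<^sup>2 + N\<^sup>2) * sin (arctan (N / D))) * sin \<theta>"
      unfolding cos_add by algebra
    then show ?thesis by (simp only: c s)
  qed
  moreover have "sqrt (D\<^sup>2 + N\<^sup>2) * sin (\<theta> + arctan (N / D)) = D * sin \<theta> + N * cos \<theta>"
  proof -
    have "sqrt (D\<^sup>2 + N\<^sup>2) * sin (\<theta> + arctan (N / D))
        = (sqrt (D\<^sup>2 + N\<^sup>2) * cos (arctan (N / D))) * sin \<theta>
          + (sqrt (D\<^sup>2 + N\<^sup>2) * sin (arctan (N / D))) * cos \<theta>"
      unfolding sin_add by algebra
    then show ?thesis by (simp only: c s)
  qed
  ultimately show ?thesis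
    using 1 2 by (simp add: vec_eq_iff forall_2 line_radius_def line_angle_def D_def N_def)
qed

lemma eventually_line_denominator_pos:
  assumes "r > 0"
  shows "\<forall>\<^sub>F t in nhds 0. r + t * radial \<theta> v > 0"
proof -
  have "((\<lambda>t. r + t * radial \<theta> v) \<longlongrightarrow> r + 0 * radial \<theta> v) (nhds 0)"
    by (intro tendsto_intros) (simp add: filterlim_ident)
  then show ?thesis using assms by (auto dest: order_tendstoD(1)[where a=0])
qed

lemma line_angle_has_derivative:
  assumes "r + t * radial \<theta> v > 0"
  shows "(line_angle r \<theta> v has_real_derivative
           r * angular \<theta> v / ((r + t * radial \<theta> v)\<^sup>2 + (t * angular \<theta> v)\<^sup>2)) (at t)"
proof -
  let ?a = "angular \<theta> v" and ?d = "radial \<theta> v"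
  have "r + t * ?d \<noteq> 0" using assms by simp
  have "((\<lambda>t. \<theta> + arctan (t * ?a / (r + t * ?d))) has_real_derivative
          inverse (1 + (t * ?a / (r + t * ?d))\<^sup>2) * ((?a * (r + t * ?d) - t * ?a * ?d) / ((r + t * ?d) * (r + t * ?d)))) (at t)"
    using \<open>r + t * ?d \<noteq> 0\<close> by (auto intro!: derivative_eq_intros)
  moreover have "inverse (1 + (t * ?a / (r + t * ?d))\<^sup>2) * ((?a * (r + t * ?d) - t * ?a * ?d) / ((r + t * ?d) * (r + t * ?d)))
      = r * ?a / ((r + t * ?d)\<^sup>2 + (t * ?a)\<^sup>2)"
  proof -
    have "1 + (t * ?a / (r + t * ?d))\<^sup>2 = ((r + t * ?d)\<^sup>2 + (t * ?a)\<^sup>2) / (r + t * ?d)\<^sup>2"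
      using \<open>r + t * ?d \<noteq> 0\<close> by (simp add: power_divide add_divide_distrib)
    then have "inverse (1 + (t * ?a / (r + t * ?d))\<^sup>2) = (r + t * ?d)\<^sup>2 / ((r + t * ?d)\<^sup>2 + (t * ?a)\<^sup>2)"
      by (simp add: inverse_eq_divide)
    moreover have "?a * (r + t * ?d) - t * ?a * ?d = r * ?a" by algebra
    moreover have "y\<^sup>2 / S * (z / (y * y)) = z / S" if "y \<noteq> 0" for y z S :: real
      using that by (simp add: power2_eq_square)
    ultimately show ?thesis using \<open>r + t * ?d \<noteq> 0\<close> by (simp only: not_False_eq_True)
  qed
  ultimately show ?thesis unfolding line_angle_def[abs_def] by simp
qed

section \<open>The barrier\<close>

text \<open>The barrier along a line, with \<open>E\<close> the exponential of a linear function and \<open>\<Theta>\<close> the polar angle;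
  \<open>w\<close> is the angular velocity.\<close>

lemma exponential_factor_derivatives:
  fixes E \<Theta> w :: "real \<Rightarrow> real"
  assumes "(E has_real_derivative c * E t) (at t)" and "(\<Theta> has_real_derivative w t) (at t)"
  shows "((\<lambda>t. (K - E t) * exp (s * \<Theta> t)) has_real_derivative
           (- c * E t + (K - E t) * (s * w t)) * exp (s * \<Theta> t)) (at t)"
    and "(w has_real_derivative w') (at t) \<Longrightarrow>
         ((\<lambda>t. (- c * E t + (K - E t) * (s * w t)) * exp (s * \<Theta> t)) has_real_derivative
           (- c\<^sup>2 * E t - 2 * c * E t * s * w t + (K - E t) * (s\<^sup>2 * (w t)\<^sup>2 + s * w'))
           * exp (s * \<Theta> t)) (at t)"
  using assms by (auto intro!: derivative_eq_intros simp: algebra_simps power2_eq_square)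

definition barrier :: "real \<Rightarrow> real \<Rightarrow> real \<Rightarrow> real \<Rightarrow> real \<Rightarrow> real" where
  "barrier K \<mu> s p \<theta> = (K - exp (\<mu> * p)) * exp (s * \<theta>)"

definition barrier_slope :: "real \<Rightarrow> real \<Rightarrow> real \<Rightarrow> real \<Rightarrow> real \<Rightarrow> real^2 \<Rightarrow> real \<Rightarrow> real" where
  "barrier_slope K \<mu> s r \<theta> v t =
     (- (\<mu> * v $ 1) * exp (\<mu> * (r * cos \<theta> + t * v $ 1))
      + (K - exp (\<mu> * (r * cos \<theta> + t * v $ 1)))
        * (s * (r * angular \<theta> v / ((r + t * radial \<theta> v)\<^sup>2 + (t * angular \<theta> v)\<^sup>2))))
     * exp (s * line_angle r \<theta> v t)"

definition barrier_curvature :: "real \<Rightarrow> real \<Rightarrow> real \<Rightarrow> real \<Rightarrow> real \<Rightarrow> real^2 \<Rightarrow> real" where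
  "barrier_curvature K \<mu> s r \<theta> v =
     (- (\<mu> * v $ 1)\<^sup>2 * exp (\<mu> * (r * cos \<theta>))
      - 2 * (\<mu> * v $ 1) * exp (\<mu> * (r * cos \<theta>)) * s * (angular \<theta> v / r)
      + (K - exp (\<mu> * (r * cos \<theta>)))
        * (s\<^sup>2 * (angular \<theta> v / r)\<^sup>2 + s * (- 2 * angular \<theta> v * radial \<theta> v / r\<^sup>2)))
     * exp (s * \<theta>)"

lemma exp_along_line:
  "((\<lambda>t. exp (\<mu> * (p + t * \<alpha>))) has_real_derivative (\<mu> * \<alpha>) * exp (\<mu> * (p + t * \<alpha>))) (at t)" for \<mu> :: real
  by (auto intro!: derivative_eq_intros)

lemma barrier_has_derivative_along_line:
  assumes "r + t * radial \<theta> v > 0"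
  shows "((\<lambda>t. barrier K \<mu> s (r * cos \<theta> + t * v $ 1) (line_angle r \<theta> v t)) has_real_derivative
           barrier_slope K \<mu> s r \<theta> v t) (at t)"
  unfolding barrier_def barrier_slope_def
  by (rule exponential_factor_derivatives(1)[OF exp_along_line, where
        w = "\<lambda>t. r * angular \<theta> v / ((r + t * radial \<theta> v)\<^sup>2 + (t * angular \<theta> v)\<^sup>2)",
        OF line_angle_has_derivative[OF assms]])

lemma barrier_slope_has_derivative:
  assumes "r > 0"
  shows "(barrier_slope K \<mu> s r \<theta> v has_real_derivative barrier_curvature K \<mu> s r \<theta> v) (at 0)"
proof -
  let ?a = "angular \<theta> v" and ?d = "radial \<theta> v"
  let ?w = "\<lambda>t. r * ?a / ((r + t * ?d)\<^sup>2 + (t * ?a)\<^sup>2)"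
  have ang: "(line_angle r \<theta> v has_real_derivative ?w 0) (at 0)"
    using line_angle_has_derivative[of r 0 \<theta> v] assms by simp
  have quot: "(?w has_real_derivative - 2 * ?a * ?d / r\<^sup>2) (at 0)"
    by (rule derivative_eq_intros refl | use assms in \<open>simp add: field_simps power2_eq_square\<close>)+
  have "?w 0 = ?a / r" using assms by (simp add: power2_eq_square)
  then show ?thesis
    using exponential_factor_derivatives(2)[OF exp_along_line[of \<mu> "r * cos \<theta>" "v $ 1" 0] ang quot, of K s]
    unfolding barrier_slope_def[abs_def] barrier_curvature_def line_polar_0 by simp
qed


text \<open>The first term is the gain from \<open>- exp (\<mu> x\<^sub>1)\<close>; all others carry a factor \<open>s\<close>. The angular
  velocity along \<open>v\<close> is at most \<open>\<bar>v\<bar> / \<rho>\<close> and the angular acceleration at most \<open>\<bar>v\<bar>\<^sup>2 / \<rho>\<^sup>2\<close>, and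
  \<open>s\<^sup>2 \<le> \<bar>s\<bar>\<close>, so the error is of order \<open>\<bar>s\<bar> \<bar>v\<bar>\<^sup>2\<close>.\<close>

lemma neg_barrier_curvature_lower_bound:
  assumes "0 < \<rho>" "\<rho> \<le> r" "\<bar>s\<bar> \<le> 1" "0 < \<mu>"
    and K: "exp (\<mu> * (r * cos \<theta>)) \<le> K"
  shows "((\<mu> * v $ 1)\<^sup>2 * exp (\<mu> * (r * cos \<theta>)) - \<bar>s\<bar> * (norm v)\<^sup>2 * (2 * \<mu> * K / \<rho> + 2 * K / \<rho>\<^sup>2))
           * exp (s * \<theta>) \<le> - barrier_curvature K \<mu> s r \<theta> v"
proof -
  define E a d n where "E = exp (\<mu> * (r * cos \<theta>))" and "a = angular \<theta> v"
    and "d = radial \<theta> v" and "n = norm v"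
  have E: "0 < E" "E \<le> K" using K by (auto simp: E_def)
  have n: "n \<ge> 0" "a\<^sup>2 + d\<^sup>2 = n\<^sup>2" "\<bar>a\<bar> \<le> n" "\<bar>v $ 1\<bar> \<le> n"
    using angular_radial_norm[of \<theta> v] abs_angular_le_norm[of \<theta> v] component_le_norm_cart[of v 1]
    by (auto simp: a_def d_def n_def)
  have r: "r > 0" using assms by simp
  have ar: "\<bar>a / r\<bar> \<le> n / \<rho>"
    using n r assms by (simp add: frac_le)
  have 1: "- 2 * (\<mu> * v $ 1) * E * s * (a / r) \<le> \<bar>s\<bar> * n\<^sup>2 * (2 * \<mu> * K / \<rho>)"
  proof -
    have "- 2 * (\<mu> * v $ 1) * E * s * (a / r) \<le> \<bar>- 2 * (\<mu> * v $ 1) * E * s * (a / r)\<bar>" by (rule abs_ge_self)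
    also have "\<dots> = (2 * \<mu> * \<bar>s\<bar>) * (E * (\<bar>v $ 1\<bar> * \<bar>a / r\<bar>))"
      using \<open>0 < \<mu>\<close> E by (simp add: abs_mult)
    also have "\<dots> \<le> (2 * \<mu> * \<bar>s\<bar>) * (K * (n * (n / \<rho>)))"
      using \<open>0 < \<mu>\<close> E n ar \<open>0 < \<rho>\<close>
      by (intro mult_left_mono mult_mono) auto
    also have "\<dots> = \<bar>s\<bar> * n\<^sup>2 * (2 * \<mu> * K / \<rho>)" by (simp add: power2_eq_square)
    finally show ?thesis .
  qed
  have 2: "s\<^sup>2 * (a / r)\<^sup>2 + s * (- 2 * a * d / r\<^sup>2) \<le> \<bar>s\<bar> * (2 * (n\<^sup>2 / \<rho>\<^sup>2))"
  proof -
    have "(a / r)\<^sup>2 \<le> (n / \<rho>)\<^sup>2"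
      using ar by (metis abs_ge_zero power2_abs power_mono)
    then have a2: "(a / r)\<^sup>2 \<le> n\<^sup>2 / \<rho>\<^sup>2" by (simp add: power_divide)
    have "s\<^sup>2 \<le> \<bar>s\<bar>"
      using \<open>\<bar>s\<bar> \<le> 1\<close> by (metis abs_ge_zero mult_left_le power2_abs power2_eq_square)
    then have A: "s\<^sup>2 * (a / r)\<^sup>2 \<le> \<bar>s\<bar> * (n\<^sup>2 / \<rho>\<^sup>2)"
      using a2 by (intro mult_mono) auto
    \<comment> \<open>The angular acceleration \<open>- 2 a d / r\<^sup>2\<close> is bounded with \<open>2 a d \<le> a\<^sup>2 + d\<^sup>2\<close>.\<close>
    have "\<bar>2 * a * d\<bar> \<le> n\<^sup>2"
      using n(2) sum_squares_bound[of "\<bar>a\<bar>" "\<bar>d\<bar>"] by (simp add: abs_mult)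
    then have "\<bar>2 * a * d\<bar> / r\<^sup>2 \<le> n\<^sup>2 / \<rho>\<^sup>2"
      using assms by (intro frac_le power_mono) auto
    then have "\<bar>s\<bar> * (\<bar>2 * a * d\<bar> / r\<^sup>2) \<le> \<bar>s\<bar> * (n\<^sup>2 / \<rho>\<^sup>2)" by (intro mult_left_mono) auto
    moreover have "s * (- 2 * a * d / r\<^sup>2) \<le> \<bar>s\<bar> * (\<bar>2 * a * d\<bar> / r\<^sup>2)"
    proof -
      have "s * (- 2 * a * d / r\<^sup>2) \<le> \<bar>s * (- 2 * a * d / r\<^sup>2)\<bar>" by (rule abs_ge_self)
      then show ?thesis by (simp add: abs_mult)
    qed
    ultimately show ?thesis using A unfolding mult_2 distrib_left by linarith
  qed
  have "(K - E) * (s\<^sup>2 * (a / r)\<^sup>2 + s * (- 2 * a * d / r\<^sup>2)) \<le> (K - E) * (\<bar>s\<bar> * (2 * (n\<^sup>2 / \<rho>\<^sup>2)))"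
    using 2 E by (intro mult_left_mono) auto
  also have "\<dots> \<le> K * (\<bar>s\<bar> * (2 * (n\<^sup>2 / \<rho>\<^sup>2)))"
    using E by (intro mult_right_mono) auto
  also have "\<dots> = \<bar>s\<bar> * n\<^sup>2 * (2 * K / \<rho>\<^sup>2)" by simp
  finally have 3: "(K - E) * (s\<^sup>2 * (a / r)\<^sup>2 + s * (- 2 * a * d / r\<^sup>2)) \<le> \<bar>s\<bar> * n\<^sup>2 * (2 * K / \<rho>\<^sup>2)" .
  have "(\<mu> * v $ 1)\<^sup>2 * E - \<bar>s\<bar> * n\<^sup>2 * (2 * \<mu> * K / \<rho> + 2 * K / \<rho>\<^sup>2)
      \<le> - (- (\<mu> * v $ 1)\<^sup>2 * E - 2 * (\<mu> * v $ 1) * E * s * (a / r)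
           + (K - E) * (s\<^sup>2 * (a / r)\<^sup>2 + s * (- 2 * a * d / r\<^sup>2)))"
    using 1 3 by (simp add: distrib_left)
  then show ?thesis
    unfolding barrier_curvature_def E_def[symmetric] a_def[symmetric] d_def[symmetric]
      n_def[symmetric] mult_minus_left[symmetric]
    by (rule mult_right_mono) simp
qed

lemma barrier_slope_lower_bound:
  assumes "0 < \<rho>" "\<rho> \<le> r" "0 < \<mu>" "norm v \<le> M"
    and K: "exp (\<mu> * (r * cos \<theta>)) \<le> K"
  shows "(- \<mu> * M * exp (\<mu> * (r * cos \<theta>)) - \<bar>s\<bar> * (K * M / \<rho>)) * exp (s * \<theta>)
           \<le> barrier_slope K \<mu> s r \<theta> v 0"
proof -
  define E a where "E = exp (\<mu> * (r * cos \<theta>))" and "a = angular \<theta> v"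
  have E: "0 < E" "E \<le> K" using K by (auto simp: E_def)
  have n: "\<bar>a\<bar> \<le> M" "\<bar>v $ 1\<bar> \<le> M" "0 \<le> M"
    using abs_angular_le_norm[of \<theta> v] component_le_norm_cart[of v 1] norm_ge_zero[of v] assms(4)
    by (auto simp: a_def simp del: norm_ge_zero)
  have r: "r > 0" using assms by simp
  have "v $ 1 * (\<mu> * E) \<le> M * (\<mu> * E)"
    using n E \<open>0 < \<mu>\<close> by (intro mult_right_mono) auto
  then have 1: "- \<mu> * M * E \<le> - (\<mu> * v $ 1) * E" by (simp add: mult_ac)
  have ar: "\<bar>a / r\<bar> \<le> M / \<rho>" using n r assms by (simp add: frac_le)
  have "- ((K - E) * (s * (a / r))) \<le> \<bar>(K - E) * (s * (a / r))\<bar>" by (rule abs_ge_minus_self)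
  also have "\<dots> = (K - E) * (\<bar>s\<bar> * \<bar>a / r\<bar>)" using E by (simp add: abs_mult)
  also have "\<dots> \<le> K * (\<bar>s\<bar> * (M / \<rho>))" using E ar n by (intro mult_mono) auto
  also have "\<dots> = \<bar>s\<bar> * (K * M / \<rho>)" by simp
  finally have "- \<mu> * M * E - \<bar>s\<bar> * (K * M / \<rho>) \<le> - (\<mu> * v $ 1) * E + (K - E) * (s * (a / r))"
    using 1 by linarith
  moreover have "barrier_slope K \<mu> s r \<theta> v 0 = (- (\<mu> * v $ 1) * E + (K - E) * (s * (a / r))) * exp (s * \<theta>)"
    using r by (simp add: barrier_slope_def E_def a_def line_polar_0 power2_eq_square)
  ultimately show ?thesis
    unfolding E_def[symmetric] by (simp add: mult_right_mono)
qed

text \<open>The last inequality says \<open>L G\<^sub>s \<ge> \<kappa> exp (s \<theta>)\<close> at a point where the coefficient matrix is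
  \<open>\<xi> \<xi>\<^sup>T + \<eta> \<eta>\<^sup>T\<close> and the drift is \<open>\<beta>\<close>. The bounds \<open>c\<close>, \<open>M\<^sub>1\<close>, \<open>M\<^sub>2\<close> and the radii \<open>\<rho>\<close>, \<open>R\<close> are all that
  the constants depend on.\<close>

lemma barrier_supersolution:
  fixes c M\<^sub>1 M\<^sub>2 \<rho> R :: real
  assumes "0 < c" "0 < M\<^sub>1" "0 \<le> M\<^sub>2" "0 < \<rho>"
  obtains K \<mu> \<nu> \<kappa> :: real where "\<mu> > 0" "\<nu> > 0" "\<kappa> > 0"
    and "\<And>r \<theta>. 0 \<le> r \<Longrightarrow> r \<le> R \<Longrightarrow> 1 \<le> K - exp (\<mu> * (r * cos \<theta>))"
    and "\<And>r \<theta> s \<xi> \<eta> \<beta>. \<rho> \<le> r \<Longrightarrow> r \<le> R \<Longrightarrow> \<bar>s\<bar> \<le> \<nu> \<Longrightarrow>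
           (\<xi> $ 1)\<^sup>2 + (\<eta> $ 1)\<^sup>2 \<ge> c \<Longrightarrow> (norm \<xi>)\<^sup>2 + (norm \<eta>)\<^sup>2 \<le> M\<^sub>1 \<Longrightarrow> norm \<beta> \<le> M\<^sub>2 \<Longrightarrow>
           \<kappa> * exp (s * \<theta>) \<le> - (barrier_curvature K \<mu> s r \<theta> \<xi> + barrier_curvature K \<mu> s r \<theta> \<eta>)
                             + barrier_slope K \<mu> s r \<theta> \<beta> 0"
proof -
  \<comment> \<open>With this \<open>\<mu>\<close> the main part of the operator is at least \<open>\<mu> (\<mu> c - M\<^sub>2) exp (\<mu> x\<^sub>1) = \<mu> exp (\<mu> x\<^sub>1)\<close>,
      hence at least \<open>2 \<kappa>\<close>; the choice of \<open>\<nu>\<close> keeps the error \<open>\<bar>s\<bar> D\<close> below \<open>\<kappa>\<close>.\<close>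
  define \<mu> where "\<mu> = (M\<^sub>2 + 1) / c"
  define K where "K = exp (\<mu> * R) + 1"
  define B where "B = 2 * \<mu> * K / \<rho> + 2 * K / \<rho>\<^sup>2"
  define D where "D = M\<^sub>1 * B + K * M\<^sub>2 / \<rho>"
  define \<kappa> where "\<kappa> = \<mu> * exp (- \<mu> * R) / 2"
  define \<nu> where "\<nu> = min 1 (\<kappa> / D)"
  have \<mu>: "\<mu> > 0" "\<mu> * c = M\<^sub>2 + 1" using assms by (auto simp: \<mu>_def)
  have "K > 0" by (simp add: K_def add_pos_pos)
  then have "B > 0" using \<mu> assms by (simp add: B_def add_pos_pos)
  then have "D > 0" using \<open>K > 0\<close> assms by (simp add: D_def add_pos_nonneg)
  have "\<kappa> > 0" using \<mu> by (simp add: \<kappa>_def)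
  have "\<nu> > 0" using \<open>\<kappa> > 0\<close> \<open>D > 0\<close> by (simp add: \<nu>_def)
  have rcos: "\<bar>r * cos \<theta>\<bar> \<le> R" if "0 \<le> r" "r \<le> R" for r \<theta>
  proof -
    have "\<bar>r * cos \<theta>\<bar> \<le> r * 1"
      unfolding abs_mult using that by (intro mult_mono) auto
    then show ?thesis using that by simp
  qed
  have upper: "exp (\<mu> * (r * cos \<theta>)) \<le> exp (\<mu> * R)" if "0 \<le> r" "r \<le> R" for r \<theta>
    using rcos[OF that, of \<theta>] \<mu> by (simp add: abs_le_iff)
  have lower: "exp (- \<mu> * R) \<le> exp (\<mu> * (r * cos \<theta>))" if "0 \<le> r" "r \<le> R" for r \<theta>
  proof -
    have "- R \<le> r * cos \<theta>" using rcos[OF that, of \<theta>] by linarith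
    then have "\<mu> * - R \<le> \<mu> * (r * cos \<theta>)" using \<mu> by (intro mult_left_mono) auto
    then show ?thesis by simp
  qed
  show thesis
  proof (rule that[OF \<mu>(1) \<open>\<nu> > 0\<close> \<open>\<kappa> > 0\<close>])
    show "1 \<le> K - exp (\<mu> * (r * cos \<theta>))" if "0 \<le> r" "r \<le> R" for r \<theta>
      using upper[OF that, of \<theta>] by (simp add: K_def)
  next
    fix r \<theta> s :: real and \<xi> \<eta> \<beta> :: "real^2"
    assume r: "\<rho> \<le> r" "r \<le> R" and s: "\<bar>s\<bar> \<le> \<nu>"
      and c: "(\<xi> $ 1)\<^sup>2 + (\<eta> $ 1)\<^sup>2 \<ge> c" and M: "(norm \<xi>)\<^sup>2 + (norm \<eta>)\<^sup>2 \<le> M\<^sub>1" and \<beta>: "norm \<beta> \<le> M\<^sub>2"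
    define E where "E = exp (\<mu> * (r * cos \<theta>))"
    have r0: "0 \<le> r" using r assms by simp
    have EK: "exp (\<mu> * (r * cos \<theta>)) \<le> K" using upper[OF r0 r(2), of \<theta>] unfolding K_def by linarith
    have E: "exp (- \<mu> * R) \<le> E" using lower[OF r0 r(2), of \<theta>] by (simp add: E_def)
    have s1: "\<bar>s\<bar> \<le> 1" and "\<bar>s\<bar> \<le> \<kappa> / D" using s by (auto simp: \<nu>_def)
    then have sD: "\<bar>s\<bar> * D \<le> \<kappa>" using \<open>D > 0\<close> by (simp add: pos_le_divide_eq)
    note curv = neg_barrier_curvature_lower_bound[OF assms(4) r(1) s1 \<mu>(1) EK, folded E_def B_def]
    note slope = barrier_slope_lower_bound[OF assms(4) r(1) \<mu>(1) \<beta> EK, of s, folded E_def]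
    have main: "2 * \<kappa> \<le> ((\<mu> * \<xi> $ 1)\<^sup>2 + (\<mu> * \<eta> $ 1)\<^sup>2) * E - \<mu> * M\<^sub>2 * E"
    proof -
      have "\<mu> * (M\<^sub>2 + 1) \<le> \<mu> * (\<mu> * ((\<xi> $ 1)\<^sup>2 + (\<eta> $ 1)\<^sup>2))"
        unfolding \<mu>(2)[symmetric] using \<mu>(1) c by (intro mult_left_mono) auto
      then have "\<mu> \<le> (\<mu> * \<xi> $ 1)\<^sup>2 + (\<mu> * \<eta> $ 1)\<^sup>2 - \<mu> * M\<^sub>2"
        by (simp add: algebra_simps power2_eq_square)
      then have "\<mu> * E \<le> ((\<mu> * \<xi> $ 1)\<^sup>2 + (\<mu> * \<eta> $ 1)\<^sup>2 - \<mu> * M\<^sub>2) * E"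
        by (intro mult_right_mono) (auto simp: E_def)
      moreover have "2 * \<kappa> \<le> \<mu> * E" using E \<mu>(1) by (simp add: \<kappa>_def)
      ultimately show ?thesis by (simp add: left_diff_distrib)
    qed
    have "\<bar>s\<bar> * ((norm \<xi>)\<^sup>2 + (norm \<eta>)\<^sup>2) * B \<le> \<bar>s\<bar> * M\<^sub>1 * B"
      using M \<open>B > 0\<close> by (intro mult_right_mono mult_left_mono) auto
    then have err: "\<bar>s\<bar> * (norm \<xi>)\<^sup>2 * B + \<bar>s\<bar> * (norm \<eta>)\<^sup>2 * B + \<bar>s\<bar> * (K * M\<^sub>2 / \<rho>) \<le> \<kappa>"
      using sD by (simp add: D_def algebra_simps)
    have "\<kappa> * exp (s * \<theta>) \<le> (((\<mu> * \<xi> $ 1)\<^sup>2 * E - \<bar>s\<bar> * (norm \<xi>)\<^sup>2 * B)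
        + ((\<mu> * \<eta> $ 1)\<^sup>2 * E - \<bar>s\<bar> * (norm \<eta>)\<^sup>2 * B)
        + (- \<mu> * M\<^sub>2 * E - \<bar>s\<bar> * (K * M\<^sub>2 / \<rho>))) * exp (s * \<theta>)"
      using main err by (intro mult_right_mono) (auto simp: distrib_right)
    also have "\<dots> = ((\<mu> * \<xi> $ 1)\<^sup>2 * E - \<bar>s\<bar> * (norm \<xi>)\<^sup>2 * B) * exp (s * \<theta>)
        + ((\<mu> * \<eta> $ 1)\<^sup>2 * E - \<bar>s\<bar> * (norm \<eta>)\<^sup>2 * B) * exp (s * \<theta>)
        + (- \<mu> * M\<^sub>2 * E - \<bar>s\<bar> * (K * M\<^sub>2 / \<rho>)) * exp (s * \<theta>)"
      by (simp only: distrib_right)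
    also have "\<dots> \<le> - barrier_curvature K \<mu> s r \<theta> \<xi> + - barrier_curvature K \<mu> s r \<theta> \<eta>
        + barrier_slope K \<mu> s r \<theta> \<beta> 0"
      by (intro add_mono curv slope)
    finally show "\<kappa> * exp (s * \<theta>) \<le> - (barrier_curvature K \<mu> s r \<theta> \<xi> + barrier_curvature K \<mu> s r \<theta> \<eta>)
                             + barrier_slope K \<mu> s r \<theta> \<beta> 0" by simp
  qed
qed

section \<open>Geometry of the spiral\<close>

lemma continuous_on_polar: "continuous_on S (\<lambda>z. polar (fst z) (snd z))"
proof -
  have "polar r \<theta> = (r * cos \<theta>) *\<^sub>R axis 1 1 + (r * sin \<theta>) *\<^sub>R axis 2 1" for r \<theta>
    by (simp add: vec_eq_iff forall_2 axis_def)
  then show ?thesis by (simp only:) (intro continuous_intros)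
qed

locale spiral =
  fixes \<theta>\<^sub>0 r_star :: real and r\<^sub>1 r\<^sub>2 :: "real \<Rightarrow> real"
  assumes cont_r1: "continuous_on {\<theta>\<^sub>0..} r\<^sub>1" and cont_r2: "continuous_on {\<theta>\<^sub>0..} r\<^sub>2"
    and r1_less_r2: "\<And>\<theta>. \<theta> \<ge> \<theta>\<^sub>0 \<Longrightarrow> r\<^sub>1 \<theta> < r\<^sub>2 \<theta>"
    and next_turn: "\<And>\<theta>. \<theta> \<ge> \<theta>\<^sub>0 \<Longrightarrow> r\<^sub>2 (\<theta> + 2 * pi) < r\<^sub>1 \<theta>"
    and r_star_pos: "0 < r_star"
    and lim_r1: "(r\<^sub>1 \<longlongrightarrow> r_star) at_top" and lim_r2: "(r\<^sub>2 \<longlongrightarrow> r_star) at_top"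
begin

abbreviation "U \<equiv> spiral_interior \<theta>\<^sub>0 r\<^sub>1 r\<^sub>2"
abbreviation "U_closed \<equiv> spiral_full \<theta>\<^sub>0 r\<^sub>1 r\<^sub>2"
abbreviation "\<gamma> \<equiv> spiral_curves \<theta>\<^sub>0 r\<^sub>1 r\<^sub>2"
abbreviation "slice \<equiv> cross_section r\<^sub>1 r\<^sub>2"

text \<open>Along a ray the inner radius decreases from turn to turn, and it tends to \<open>r_star\<close>.\<close>

lemma r_star_le_r1:
  assumes "\<theta> \<ge> \<theta>\<^sub>0"
  shows "r_star \<le> r\<^sub>1 \<theta>"
proof -
  define X where "X n = r\<^sub>1 (\<theta> + real n * (2 * pi))" for n
  have "decseq X"
  proof (rule decseq_SucI)
    fix n
    have "0 \<le> real n * (2 * pi)" by simp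
    then have ge: "\<theta> + real n * (2 * pi) \<ge> \<theta>\<^sub>0" "\<theta> + real n * (2 * pi) + 2 * pi \<ge> \<theta>\<^sub>0"
      using assms pi_gt_zero by linarith+
    have "\<theta> + real (Suc n) * (2 * pi) = \<theta> + real n * (2 * pi) + 2 * pi"
      by (simp add: algebra_simps)
    then have "X (Suc n) = r\<^sub>1 (\<theta> + real n * (2 * pi) + 2 * pi)" by (simp only: X_def)
    then show "X (Suc n) \<le> X n"
      using r1_less_r2[OF ge(2)] next_turn[OF ge(1)] unfolding X_def[of n] by linarith
  qed
  moreover have "X \<longlonglongrightarrow> r_star"
  proof -
    have "filterlim (\<lambda>n. real n * (2 * pi)) at_top sequentially"
      by (rule filterlim_at_top_mult_tendsto_pos[OF tendsto_const _ filterlim_real_sequentially]) simp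
    then have "filterlim (\<lambda>n. \<theta> + real n * (2 * pi)) at_top sequentially"
      by (rule filterlim_tendsto_add_at_top[OF tendsto_const])
    then show ?thesis
      unfolding X_def by (rule filterlim_compose[OF lim_r1])
  qed
  ultimately have "r_star \<le> X 0" by (rule decseq_ge)
  then show ?thesis by (simp add: X_def)
qed

lemma r2_bounded:
  obtains R where "\<And>\<theta>. \<theta> \<ge> \<theta>\<^sub>0 \<Longrightarrow> r\<^sub>2 \<theta> \<le> R"
proof -
  have "\<forall>\<^sub>F \<theta> in at_top. r\<^sub>2 \<theta> < r_star + 1"
    using order_tendstoD(2)[OF lim_r2] by simp
  then obtain N where N: "\<And>\<theta>. \<theta> \<ge> N \<Longrightarrow> r\<^sub>2 \<theta> < r_star + 1"
    by (auto simp: eventually_at_top_linorder)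
  have "compact (r\<^sub>2 ` {\<theta>\<^sub>0..N})"
    by (rule compact_continuous_image[OF continuous_on_subset[OF cont_r2]]) auto
  then obtain B where B: "\<And>\<theta>. \<theta> \<in> {\<theta>\<^sub>0..N} \<Longrightarrow> \<bar>r\<^sub>2 \<theta>\<bar> \<le> B"
    by (meson bounded_real compact_imp_bounded imageI)
  have "r\<^sub>2 \<theta> \<le> max B (r_star + 1)" if "\<theta> \<ge> \<theta>\<^sub>0" for \<theta>
    using B[of \<theta>] N[of \<theta>] that by (cases "\<theta> \<le> N") auto
  then show thesis by (rule that)
qed

lemma compact_truncated_spiral:
  assumes "\<theta>\<^sub>0 \<le> T"
  shows "compact {(r, \<theta>). T \<le> \<theta> \<and> \<theta> \<le> T' \<and> r\<^sub>1 \<theta> \<le> r \<and> r \<le> r\<^sub>2 \<theta>}" (is "compact ?K")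
proof -
  let ?g = "\<lambda>(\<theta>, \<tau>). (r\<^sub>1 \<theta> + \<tau> * (r\<^sub>2 \<theta> - r\<^sub>1 \<theta>), \<theta>)"
  have "?K = ?g ` ({T..T'} \<times> {0..1})"
  proof (intro equalityI subsetI)
    fix z assume "z \<in> ?K"
    then obtain r \<theta> where z: "z = (r, \<theta>)" "T \<le> \<theta>" "\<theta> \<le> T'" "r\<^sub>1 \<theta> \<le> r" "r \<le> r\<^sub>2 \<theta>" by auto
    have lt: "r\<^sub>1 \<theta> < r\<^sub>2 \<theta>" using z assms r1_less_r2 by auto
    have "z = ?g (\<theta>, (r - r\<^sub>1 \<theta>) / (r\<^sub>2 \<theta> - r\<^sub>1 \<theta>))" using lt z by simp
    moreover have "(\<theta>, (r - r\<^sub>1 \<theta>) / (r\<^sub>2 \<theta> - r\<^sub>1 \<theta>)) \<in> {T..T'} \<times> {0..1}"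
      using z lt by (auto simp: divide_le_eq)
    ultimately show "z \<in> ?g ` ({T..T'} \<times> {0..1})" by blast
  next
    fix z assume "z \<in> ?g ` ({T..T'} \<times> {0..1})"
    then obtain w where w: "w \<in> {T..T'} \<times> {0..1}" "z = ?g w" by blast
    obtain \<theta> \<tau> where "w = (\<theta>, \<tau>)" by (cases w)
    with w have z: "z = (r\<^sub>1 \<theta> + \<tau> * (r\<^sub>2 \<theta> - r\<^sub>1 \<theta>), \<theta>)" "T \<le> \<theta>" "\<theta> \<le> T'" "0 \<le> \<tau>" "\<tau> \<le> 1"
      by auto
    have lt: "0 < r\<^sub>2 \<theta> - r\<^sub>1 \<theta>" using z assms r1_less_r2 by auto
    then have "0 \<le> \<tau> * (r\<^sub>2 \<theta> - r\<^sub>1 \<theta>)" "\<tau> * (r\<^sub>2 \<theta> - r\<^sub>1 \<theta>) \<le> 1 * (r\<^sub>2 \<theta> - r\<^sub>1 \<theta>)"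
      using z by (intro mult_nonneg_nonneg mult_right_mono; simp)+
    then show "z \<in> ?K" using z by auto
  qed
  moreover have "continuous_on ({T..T'} \<times> {0..1}) ?g"
    unfolding case_prod_beta
    by (intro continuous_intros continuous_on_compose2[OF cont_r1] continuous_on_compose2[OF cont_r2])
      (use assms in auto)
  ultimately show ?thesis by (simp add: compact_continuous_image compact_Times)
qed

text \<open>Polar coordinates along a line are continuous in \<open>t\<close>, and so are the two sides of the spiral as
  functions of the angle; the strict inequalities at \<open>t = 0\<close> therefore persist. This takes the place of
  openness of the spiral, and it also keeps track of the branch of the angle.\<close>

lemma eventually_line_in_truncated_spiral:
  assumes T: "\<theta>\<^sub>0 \<le> T" "T < \<theta>" "\<theta> < T'" and r: "r\<^sub>1 \<theta> < r" "r < r\<^sub>2 \<theta>"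
  shows "\<forall>\<^sub>F t in nhds 0. polar r \<theta> + t *\<^sub>R v = polar (line_radius r \<theta> v t) (line_angle r \<theta> v t) \<and>
           T < line_angle r \<theta> v t \<and> line_angle r \<theta> v t < T' \<and>
           r\<^sub>1 (line_angle r \<theta> v t) < line_radius r \<theta> v t \<and>
           line_radius r \<theta> v t < r\<^sub>2 (line_angle r \<theta> v t)"
proof -
  have r0: "r > 0" using r_star_le_r1[of \<theta>] r_star_pos T r by simp
  have "isCont (line_angle r \<theta> v) 0"
    using line_angle_has_derivative[of r 0 \<theta> v] r0 by (intro DERIV_isCont) auto
  then have ang: "(line_angle r \<theta> v \<longlongrightarrow> \<theta>) (nhds 0)"
    using line_polar_0(2)[of r \<theta> v] by (simp add: isCont_def tendsto_nhds_iff)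
  have "(line_radius r \<theta> v \<longlongrightarrow> line_radius r \<theta> v 0) (nhds 0)"
    unfolding line_radius_def by (intro tendsto_intros) (simp_all add: filterlim_ident)
  then have rad: "(line_radius r \<theta> v \<longlongrightarrow> r) (nhds 0)" using line_polar_0(1)[OF r0] by simp
  have "isCont r\<^sub>1 \<theta>" "isCont r\<^sub>2 \<theta>"
    using cont_r1 cont_r2 T by (auto intro!: continuous_on_interior[of "{\<theta>\<^sub>0..}"])
  then have r12: "((\<lambda>t. r\<^sub>1 (line_angle r \<theta> v t)) \<longlongrightarrow> r\<^sub>1 \<theta>) (nhds 0)"
      "((\<lambda>t. r\<^sub>2 (line_angle r \<theta> v t)) \<longlongrightarrow> r\<^sub>2 \<theta>) (nhds 0)"
    using ang by (auto intro: isCont_tendsto_compose)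
  have "\<forall>\<^sub>F t in nhds 0. 0 < line_radius r \<theta> v t - r\<^sub>1 (line_angle r \<theta> v t)"
    using tendsto_diff[OF rad r12(1)] r by (intro order_tendstoD(1)) auto
  moreover have "\<forall>\<^sub>F t in nhds 0. 0 < r\<^sub>2 (line_angle r \<theta> v t) - line_radius r \<theta> v t"
    using tendsto_diff[OF r12(2) rad] r by (intro order_tendstoD(1)) auto
  ultimately show ?thesis
    using order_tendstoD(1)[OF ang T(2)] order_tendstoD(2)[OF ang T(3)]
      eventually_line_denominator_pos[OF r0, of \<theta> v]
    by eventually_elim (auto simp: line_eq_polar)
qed

end

section \<open>Comparison with the barrier\<close>

locale elliptic_spiral = spiral +
  fixes c\<^sub>0 M\<^sub>1 M\<^sub>2 :: real and A :: "real^2 \<Rightarrow> real^2^2" and b :: "real^2 \<Rightarrow> real^2"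
  assumes symmetric: "\<And>x. x \<in> U \<Longrightarrow> transpose (A x) = A x"
    and c0_pos: "0 < c\<^sub>0"
    and elliptic: "\<And>x \<xi>. x \<in> U \<Longrightarrow> \<xi> \<bullet> (A x *v \<xi>) \<ge> c\<^sub>0 * (norm \<xi>)\<^sup>2"
    and trace_le: "\<And>x. x \<in> U \<Longrightarrow> trace (A x) \<le> M\<^sub>1"
    and drift_le: "\<And>x. x \<in> U \<Longrightarrow> norm (b x) \<le> M\<^sub>2"

text \<open>The constants produced by \<open>barrier_supersolution\<close> for \<open>\<rho> = r_star\<close>, kept fixed so that the estimates
  below use the same ones for every starting angle and every solution.\<close>

locale elliptic_spiral_barrier = elliptic_spiral +
  fixes K \<mu> \<nu> \<kappa> R :: real
  assumes \<nu>_pos: "\<nu> > 0" and \<kappa>_pos: "\<kappa> > 0"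
    and r2_le: "\<And>\<theta>. \<theta> \<ge> \<theta>\<^sub>0 \<Longrightarrow> r\<^sub>2 \<theta> \<le> R"
    and factor_ge_1: "\<And>r \<theta>. 0 \<le> r \<Longrightarrow> r \<le> R \<Longrightarrow> 1 \<le> K - exp (\<mu> * (r * cos \<theta>))"
    and supersolution: "\<And>r \<theta> s \<xi> \<eta> \<beta>. r_star \<le> r \<Longrightarrow> r \<le> R \<Longrightarrow> \<bar>s\<bar> \<le> \<nu> \<Longrightarrow>
           (\<xi> $ 1)\<^sup>2 + (\<eta> $ 1)\<^sup>2 \<ge> c\<^sub>0 \<Longrightarrow> (norm \<xi>)\<^sup>2 + (norm \<eta>)\<^sup>2 \<le> M\<^sub>1 \<Longrightarrow> norm \<beta> \<le> M\<^sub>2 \<Longrightarrow>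
           \<kappa> * exp (s * \<theta>) \<le> - (barrier_curvature K \<mu> s r \<theta> \<xi> + barrier_curvature K \<mu> s r \<theta> \<eta>)
                             + barrier_slope K \<mu> s r \<theta> \<beta> 0"
begin

lemma K_pos: "K > 0"
proof -
  have "0 \<le> R" using r2_le[of \<theta>\<^sub>0] r1_less_r2[of \<theta>\<^sub>0] r_star_le_r1[of \<theta>\<^sub>0] r_star_pos by simp
  then have "1 \<le> K - exp (\<mu> * (0 * cos 0))" by (intro factor_ge_1) auto
  then show ?thesis by simp
qed

lemma radius_bounds:
  assumes "\<theta>\<^sub>0 \<le> \<theta>" "r\<^sub>1 \<theta> \<le> r" "r \<le> r\<^sub>2 \<theta>"
  shows "r_star \<le> r" "0 < r" "r \<le> R"
  using r_star_le_r1[OF assms(1)] r_star_pos r2_le[OF assms(1)] assms by auto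

lemma barrier_bounds:
  assumes "\<theta>\<^sub>0 \<le> \<theta>" "r\<^sub>1 \<theta> \<le> r" "r \<le> r\<^sub>2 \<theta>"
  shows "exp (s * \<theta>) \<le> barrier K \<mu> s (r * cos \<theta>) \<theta>"
    and "barrier K \<mu> s (r * cos \<theta>) \<theta> \<le> K * exp (s * \<theta>)"
proof -
  have "1 \<le> K - exp (\<mu> * (r * cos \<theta>))"
    using radius_bounds[OF assms] by (intro factor_ge_1) auto
  then show "exp (s * \<theta>) \<le> barrier K \<mu> s (r * cos \<theta>) \<theta>"
    unfolding barrier_def using mult_right_mono[of 1 "K - exp (\<mu> * (r * cos \<theta>))" "exp (s * \<theta>)"] by simp
  show "barrier K \<mu> s (r * cos \<theta>) \<theta> \<le> K * exp (s * \<theta>)"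
    unfolding barrier_def by (intro mult_right_mono) auto
qed

text \<open>The maximum of \<open>\<sigma> u - W\<close> over the truncated spiral cannot be positive: on each of the four sides of
  this curvilinear rectangle one term of \<open>W\<close> dominates \<open>\<sigma> u\<close>, and at an interior maximum the operator
  applied to \<open>\<sigma> u\<close> would be at least \<open>L W\<close>, which exceeds \<open>m\<^sub>f\<close> strictly thanks to the term with \<open>\<epsilon>\<close>.
  Working in the coordinates \<open>(r, \<theta>)\<close> makes the angle a plain variable.\<close>

lemma strict_comparison:
  fixes u :: "real^2 \<Rightarrow> real" and \<sigma> m\<^sub>B m\<^sub>f m\<^sub>T T \<epsilon> :: real
  assumes C2: "C2_on U u" and cont: "continuous_on U_closed u" and T: "\<theta>\<^sub>0 \<le> T"
    and m: "0 \<le> m\<^sub>B" "0 \<le> m\<^sub>f" "0 \<le> m\<^sub>T" and \<epsilon>: "0 < \<epsilon>"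
    and sides: "\<And>\<theta>. T \<le> \<theta> \<Longrightarrow> \<sigma> * u (polar (r\<^sub>1 \<theta>) \<theta>) \<le> m\<^sub>B"
      "\<And>\<theta>. T \<le> \<theta> \<Longrightarrow> \<sigma> * u (polar (r\<^sub>2 \<theta>) \<theta>) \<le> m\<^sub>B"
    and start: "\<And>r. r\<^sub>1 T \<le> r \<Longrightarrow> r \<le> r\<^sub>2 T \<Longrightarrow> \<sigma> * u (polar r T) \<le> m\<^sub>T"
    and source: "\<And>\<theta> r. T < \<theta> \<Longrightarrow> r\<^sub>1 \<theta> < r \<Longrightarrow> r < r\<^sub>2 \<theta> \<Longrightarrow> \<sigma> * nondiv_op A b u (polar r \<theta>) \<le> m\<^sub>f"
    and far: "\<And>r. r\<^sub>1 T' \<le> r \<Longrightarrow> r \<le> r\<^sub>2 T' \<Longrightarrow> \<sigma> * u (polar r T') \<le> \<epsilon> * exp (\<nu> * T')"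
    and z: "T \<le> \<theta>" "\<theta> \<le> T'" "r\<^sub>1 \<theta> \<le> r" "r \<le> r\<^sub>2 \<theta>"
  shows "\<sigma> * u (polar r \<theta>) \<le> m\<^sub>B + m\<^sub>f / \<kappa> * barrier K \<mu> 0 (r * cos \<theta>) \<theta>
           + m\<^sub>T * exp (\<nu> * T) * barrier K \<mu> (- \<nu>) (r * cos \<theta>) \<theta>
           + \<epsilon> * barrier K \<mu> \<nu> (r * cos \<theta>) \<theta>"
proof -
  define W where "W p \<theta> = m\<^sub>B + m\<^sub>f / \<kappa> * barrier K \<mu> 0 p \<theta>
           + m\<^sub>T * exp (\<nu> * T) * barrier K \<mu> (- \<nu>) p \<theta> + \<epsilon> * barrier K \<mu> \<nu> p \<theta>" for p \<theta>
  define h where "h z = \<sigma> * u (polar (fst z) (snd z)) - W (fst z * cos (snd z)) (snd z)" for z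
  define Kc where "Kc = {(r, \<theta>). T \<le> \<theta> \<and> \<theta> \<le> T' \<and> r\<^sub>1 \<theta> \<le> r \<and> r \<le> r\<^sub>2 \<theta>}"
  have "compact Kc" unfolding Kc_def by (rule compact_truncated_spiral[OF T])
  moreover have "(r, \<theta>) \<in> Kc" using z by (simp add: Kc_def)
  moreover have "continuous_on Kc h"
  proof -
    have "continuous_on Kc (\<lambda>z. u (polar (fst z) (snd z)))"
      by (rule continuous_on_compose2[OF cont continuous_on_polar])
        (use T in \<open>force simp: Kc_def spiral_full_def\<close>)
    then show ?thesis unfolding h_def W_def barrier_def by (intro continuous_intros)
  qed
  ultimately obtain z1 where "z1 \<in> Kc" and max1: "\<And>z. z \<in> Kc \<Longrightarrow> h z \<le> h z1"
    using continuous_attains_sup[of Kc h] by blast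
  obtain r' \<theta>' where "z1 = (r', \<theta>')" by (cases z1)
  with \<open>z1 \<in> Kc\<close> have z': "T \<le> \<theta>'" "\<theta>' \<le> T'" "r\<^sub>1 \<theta>' \<le> r'" "r' \<le> r\<^sub>2 \<theta>'"
    by (auto simp: Kc_def)
  have max: "h (s, \<alpha>) \<le> h (r', \<theta>')"
    if "T \<le> \<alpha>" "\<alpha> \<le> T'" "r\<^sub>1 \<alpha> \<le> s" "s \<le> r\<^sub>2 \<alpha>" for s \<alpha>
    using max1[of "(s, \<alpha>)"] that \<open>z1 = _\<close> by (simp add: Kc_def)
  have \<theta>0: "\<theta>\<^sub>0 \<le> \<theta>'" using T z' by simp
  note bb = barrier_bounds[OF \<theta>0 z'(3,4)]
  have nn: "0 \<le> barrier K \<mu> s (r' * cos \<theta>') \<theta>'" for s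
    using bb(1)[of s] order_trans[OF exp_ge_zero] by blast
  have terms: "0 \<le> m\<^sub>f / \<kappa> * barrier K \<mu> 0 (r' * cos \<theta>') \<theta>'"
      "0 \<le> m\<^sub>T * exp (\<nu> * T) * barrier K \<mu> (- \<nu>) (r' * cos \<theta>') \<theta>'"
      "0 \<le> \<epsilon> * barrier K \<mu> \<nu> (r' * cos \<theta>') \<theta>'"
    using nn m \<epsilon> \<kappa>_pos by (simp_all only: mult_nonneg_nonneg divide_nonneg_pos exp_ge_zero less_imp_le)
  have "h (r', \<theta>') \<le> 0"
  proof (rule ccontr)
    assume "\<not> h (r', \<theta>') \<le> 0"
    then have pos: "W (r' * cos \<theta>') \<theta>' < \<sigma> * u (polar r' \<theta>')" by (simp add: h_def)
    have "\<theta>' \<noteq> T"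
    proof
      assume eq: "\<theta>' = T"
      have "m\<^sub>T * exp (\<nu> * T) * exp (- \<nu> * T) \<le> m\<^sub>T * exp (\<nu> * T) * barrier K \<mu> (- \<nu>) (r' * cos \<theta>') \<theta>'"
        using bb(1)[of "- \<nu>"] m eq by (intro mult_left_mono) auto
      then have "m\<^sub>T \<le> m\<^sub>T * exp (\<nu> * T) * barrier K \<mu> (- \<nu>) (r' * cos \<theta>') \<theta>'"
        by (simp add: mult.assoc flip: exp_add)
      then have "m\<^sub>T \<le> W (r' * cos \<theta>') \<theta>'" unfolding W_def using terms m by linarith
      then show False using start[of r'] z' pos eq by simp
    qed
    moreover have "\<theta>' \<noteq> T'"
    proof
      assume eq: "\<theta>' = T'"
      have "\<epsilon> * exp (\<nu> * T') \<le> \<epsilon> * barrier K \<mu> \<nu> (r' * cos \<theta>') \<theta>'"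
        using bb(1)[of "\<nu>"] \<epsilon> eq by (intro mult_left_mono) auto
      then have "\<epsilon> * exp (\<nu> * T') \<le> W (r' * cos \<theta>') \<theta>'" unfolding W_def using terms m by linarith
      then show False using far[of r'] z' pos eq by simp
    qed
    moreover have "m\<^sub>B \<le> W (r' * cos \<theta>') \<theta>'" unfolding W_def using terms by linarith
    then have "r' \<noteq> r\<^sub>1 \<theta>'" "r' \<noteq> r\<^sub>2 \<theta>'" using sides[OF z'(1)] pos by auto
    ultimately have int: "T < \<theta>'" "\<theta>' < T'" "r\<^sub>1 \<theta>' < r'" "r' < r\<^sub>2 \<theta>'" using z' by auto
    note line = eventually_line_in_truncated_spiral[OF T int]
    define x where "x = polar r' \<theta>'"
    have xU: "x \<in> U" unfolding x_def spiral_interior_def using int T by force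
    have r'0: "0 < r'" "r_star \<le> r'" "r' \<le> R" using radius_bounds[OF \<theta>0 z'(3,4)] by auto
    obtain \<xi> \<eta> where dec: "\<And>i j. A x $ i $ j = \<xi> $ i * \<xi> $ j + \<eta> $ i * \<eta> $ j"
      "(\<xi> $ 1)\<^sup>2 + (\<eta> $ 1)\<^sup>2 \<ge> c\<^sub>0" "(norm \<xi>)\<^sup>2 + (norm \<eta>)\<^sup>2 = trace (A x)"
      using symmetric_matrix_2_as_sum_of_squares[OF symmetric[OF xU] c0_pos elliptic[OF xU]] by blast
    define \<phi> where "\<phi> v t = W (r' * cos \<theta>' + t * v $ 1) (line_angle r' \<theta>' v t)" for v t
    define \<phi>' where "\<phi>' v t = m\<^sub>f / \<kappa> * barrier_slope K \<mu> 0 r' \<theta>' v t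
        + m\<^sub>T * exp (\<nu> * T) * barrier_slope K \<mu> (- \<nu>) r' \<theta>' v t
        + \<epsilon> * barrier_slope K \<mu> \<nu> r' \<theta>' v t" for v t
    define \<phi>'' where "\<phi>'' v = m\<^sub>f / \<kappa> * barrier_curvature K \<mu> 0 r' \<theta>' v
        + m\<^sub>T * exp (\<nu> * T) * barrier_curvature K \<mu> (- \<nu>) r' \<theta>' v
        + \<epsilon> * barrier_curvature K \<mu> \<nu> r' \<theta>' v" for v
    have "- (\<phi>'' \<xi> + \<phi>'' \<eta>) + \<phi>' (b x) 0 \<le> \<sigma> * nondiv_op A b u x"
    proof (rule touching_point_inequality[where \<phi> = \<phi> and S = U])
      show "C2_on U u" by (rule C2)
      show "\<forall>\<^sub>F t in nhds 0. x + t *\<^sub>R v \<in> U" for v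
        using line[of v] unfolding x_def
      proof eventually_elim
        case (elim t)
        then show ?case unfolding spiral_interior_def using T by force
      qed
      show "A x $ i $ j = \<xi> $ i * \<xi> $ j + \<eta> $ i * \<eta> $ j" for i j by (rule dec)
      show "\<forall>\<^sub>F t in nhds 0. (\<phi> v has_real_derivative \<phi>' v t) (at t)" for v
        using eventually_line_denominator_pos[OF r'0(1), of \<theta>' v]
      proof eventually_elim
        case (elim t)
        note d = barrier_has_derivative_along_line[OF elim]
        show ?case
          unfolding \<phi>_def[abs_def] \<phi>'_def W_def
          using DERIV_add[OF DERIV_add[OF DERIV_add[OF DERIV_const[of m\<^sub>B] DERIV_cmult[OF d[of K \<mu> 0], of "m\<^sub>f / \<kappa>"]]
              DERIV_cmult[OF d[of K \<mu> "- \<nu>"], of "m\<^sub>T * exp (\<nu> * T)"]] DERIV_cmult[OF d[of K \<mu> \<nu>], of \<epsilon>]]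
          by simp
      qed
      show "(\<phi>' v has_real_derivative \<phi>'' v) (at 0)" for v
        unfolding \<phi>'_def[abs_def] \<phi>''_def
        by (intro DERIV_add DERIV_cmult barrier_slope_has_derivative r'0)
      show "\<forall>\<^sub>F t in nhds 0. \<sigma> * u (x + t *\<^sub>R v) - \<phi> v t \<le> \<sigma> * u x - \<phi> v 0" for v
        using line[of v]
      proof eventually_elim
        case (elim t)
        then have "h (line_radius r' \<theta>' v t, line_angle r' \<theta>' v t) \<le> h (r', \<theta>')"
          by (intro max) auto
        moreover have "r' * cos \<theta>' + t * v $ 1 = line_radius r' \<theta>' v t * cos (line_angle r' \<theta>' v t)"
          using arg_cong[OF conjunct1[OF elim], of "\<lambda>y. y $ 1"] by simp
        ultimately show ?case
          using elim by (simp add: h_def \<phi>_def x_def line_polar_0)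
      qed
    qed
    moreover have "m\<^sub>f < - (\<phi>'' \<xi> + \<phi>'' \<eta>) + \<phi>' (b x) 0"
    proof -
      \<comment> \<open>\<open>Q s\<close> is the operator applied to \<open>G\<^sub>s\<close> at the maximum point.\<close>
      define Q where "Q s = - (barrier_curvature K \<mu> s r' \<theta>' \<xi> + barrier_curvature K \<mu> s r' \<theta>' \<eta>)
                             + barrier_slope K \<mu> s r' \<theta>' (b x) 0" for s
      have Q: "\<kappa> * exp (s * \<theta>') \<le> Q s" if "\<bar>s\<bar> \<le> \<nu>" for s
        unfolding Q_def using that r'0 dec trace_le[OF xU] drift_le[OF xU] by (intro supersolution) auto
      have Q_pos: "0 < Q s" if "\<bar>s\<bar> \<le> \<nu>" for s
        using Q[OF that] mult_pos_pos[OF \<kappa>_pos exp_gt_zero[of "s * \<theta>'"]] by linarith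
      have q: "\<kappa> \<le> Q 0" "0 < Q (- \<nu>)" "0 < Q \<nu>"
        using Q[of 0] \<nu>_pos by (auto intro!: Q_pos)
      have "m\<^sub>f = m\<^sub>f / \<kappa> * \<kappa>" using \<kappa>_pos by simp
      also have "\<dots> \<le> m\<^sub>f / \<kappa> * Q 0" using q m \<kappa>_pos by (intro mult_left_mono) auto
      also have "\<dots> < m\<^sub>f / \<kappa> * Q 0 + m\<^sub>T * exp (\<nu> * T) * Q (- \<nu>) + \<epsilon> * Q \<nu>"
        using q m \<epsilon> by (simp add: add_nonneg_pos)
      also have "\<dots> = - (\<phi>'' \<xi> + \<phi>'' \<eta>) + \<phi>' (b x) 0"
        unfolding Q_def \<phi>''_def \<phi>'_def by algebra
      finally show ?thesis .
    qed
    ultimately show False using source[OF int(1,3,4)] by (simp add: x_def)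
  qed
  then have "h (r, \<theta>) \<le> 0" using max[OF z] by linarith
  then show ?thesis by (simp add: h_def W_def)
qed

text \<open>For fixed \<open>(r, \<theta>)\<close> the term with \<open>\<epsilon>\<close> is made at most \<open>e\<close>, and only then the truncation \<open>T'\<close> is chosen
  so far out that the growth condition holds for this \<open>\<epsilon>\<close>.\<close>

lemma comparison:
  fixes u :: "real^2 \<Rightarrow> real" and \<sigma> m\<^sub>B m\<^sub>f m\<^sub>T T :: real
  assumes C2: "C2_on U u" and cont: "continuous_on U_closed u" and T: "\<theta>\<^sub>0 \<le> T"
    and m: "0 \<le> m\<^sub>B" "0 \<le> m\<^sub>f" "0 \<le> m\<^sub>T"
    and sides: "\<And>\<theta>. T \<le> \<theta> \<Longrightarrow> \<sigma> * u (polar (r\<^sub>1 \<theta>) \<theta>) \<le> m\<^sub>B"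
      "\<And>\<theta>. T \<le> \<theta> \<Longrightarrow> \<sigma> * u (polar (r\<^sub>2 \<theta>) \<theta>) \<le> m\<^sub>B"
    and start: "\<And>r. r\<^sub>1 T \<le> r \<Longrightarrow> r \<le> r\<^sub>2 T \<Longrightarrow> \<sigma> * u (polar r T) \<le> m\<^sub>T"
    and source: "\<And>\<theta> r. T < \<theta> \<Longrightarrow> r\<^sub>1 \<theta> < r \<Longrightarrow> r < r\<^sub>2 \<theta> \<Longrightarrow> \<sigma> * nondiv_op A b u (polar r \<theta>) \<le> m\<^sub>f"
    and growth: "\<And>\<epsilon>. 0 < \<epsilon> \<Longrightarrow> \<forall>\<^sub>F \<theta> in at_top. \<forall>r\<in>{r\<^sub>1 \<theta>..r\<^sub>2 \<theta>}. \<sigma> * u (polar r \<theta>) \<le> \<epsilon> * exp (\<nu> * \<theta>)"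
    and z: "T \<le> \<theta>" "r\<^sub>1 \<theta> \<le> r" "r \<le> r\<^sub>2 \<theta>"
  shows "\<sigma> * u (polar r \<theta>) \<le> m\<^sub>B + K / \<kappa> * m\<^sub>f + K * m\<^sub>T * exp (- \<nu> * (\<theta> - T))"
proof (rule field_le_epsilon)
  fix e :: real assume "e > 0"
  define \<epsilon> where "\<epsilon> = e / (K * exp (\<nu> * \<theta>))"
  have \<epsilon>: "\<epsilon> > 0" using \<open>e > 0\<close> K_pos by (simp add: \<epsilon>_def)
  obtain T' where T': "T' \<ge> \<theta>" "\<forall>r\<in>{r\<^sub>1 T'..r\<^sub>2 T'}. \<sigma> * u (polar r T') \<le> \<epsilon> * exp (\<nu> * T')"
    using eventually_happens'[OF _ eventually_conj[OF eventually_ge_at_top[of \<theta>] growth[OF \<epsilon>]]] by auto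
  have "\<sigma> * u (polar r \<theta>) \<le> m\<^sub>B + m\<^sub>f / \<kappa> * barrier K \<mu> 0 (r * cos \<theta>) \<theta>
           + m\<^sub>T * exp (\<nu> * T) * barrier K \<mu> (- \<nu>) (r * cos \<theta>) \<theta>
           + \<epsilon> * barrier K \<mu> \<nu> (r * cos \<theta>) \<theta>"
    by (rule strict_comparison[where T' = T', OF C2 cont T m \<epsilon> sides start source]) (use T' z in auto)
  also have "\<dots> \<le> m\<^sub>B + m\<^sub>f / \<kappa> * (K * exp (0 * \<theta>)) + m\<^sub>T * exp (\<nu> * T) * (K * exp (- \<nu> * \<theta>))
           + \<epsilon> * (K * exp (\<nu> * \<theta>))"
    using m \<epsilon> \<kappa>_pos
    by (intro add_mono mult_left_mono order_refl barrier_bounds(2)[OF order_trans[OF T z(1)] z(2,3)]) auto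
  also have "m\<^sub>f / \<kappa> * (K * exp (0 * \<theta>)) = K / \<kappa> * m\<^sub>f" by simp
  also have "\<epsilon> * (K * exp (\<nu> * \<theta>)) = e" using K_pos by (simp add: \<epsilon>_def)
  also have "m\<^sub>T * exp (\<nu> * T) * (K * exp (- \<nu> * \<theta>)) = K * m\<^sub>T * (exp (\<nu> * T) * exp (- \<nu> * \<theta>))"
    by simp
  also have "exp (\<nu> * T) * exp (- \<nu> * \<theta>) = exp (- \<nu> * (\<theta> - T))"
    by (simp add: algebra_simps flip: exp_add)
  finally show "\<sigma> * u (polar r \<theta>) \<le> m\<^sub>B + K / \<kappa> * m\<^sub>f + K * m\<^sub>T * exp (- \<nu> * (\<theta> - T)) + e" .
qed

lemma slice_estimate:
  fixes u :: "real^2 \<Rightarrow> real" and m\<^sub>B m\<^sub>f m\<^sub>T T :: real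
  assumes C2: "C2_on U u" and cont: "continuous_on U_closed u" and T: "\<theta>\<^sub>0 \<le> T"
    and growth: "below_exp_growth r\<^sub>1 r\<^sub>2 u"
    and sides: "\<And>\<theta>. T \<le> \<theta> \<Longrightarrow> \<bar>u (polar (r\<^sub>1 \<theta>) \<theta>)\<bar> \<le> m\<^sub>B"
      "\<And>\<theta>. T \<le> \<theta> \<Longrightarrow> \<bar>u (polar (r\<^sub>2 \<theta>) \<theta>)\<bar> \<le> m\<^sub>B"
    and start: "\<And>r. r\<^sub>1 T \<le> r \<Longrightarrow> r \<le> r\<^sub>2 T \<Longrightarrow> \<bar>u (polar r T)\<bar> \<le> m\<^sub>T"
    and source: "\<And>\<theta> r. T < \<theta> \<Longrightarrow> r\<^sub>1 \<theta> < r \<Longrightarrow> r < r\<^sub>2 \<theta> \<Longrightarrow> \<bar>nondiv_op A b u (polar r \<theta>)\<bar> \<le> m\<^sub>f"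
    and \<theta>: "T \<le> \<theta>"
  shows "sup_abs u (slice \<theta>) \<le> m\<^sub>B + K / \<kappa> * m\<^sub>f + K * m\<^sub>T * exp (- \<nu> * (\<theta> - T))"
proof -
  have lt: "r\<^sub>1 \<alpha> < r\<^sub>2 \<alpha>" if "T \<le> \<alpha>" for \<alpha> using r1_less_r2 T that by simp
  have m0: "0 \<le> m\<^sub>B" "0 \<le> m\<^sub>T"
    using order_trans[OF abs_ge_zero sides(1)[of T]] order_trans[OF abs_ge_zero start[of "r\<^sub>1 T"]] lt[of T] by auto
  have m1: "0 \<le> m\<^sub>f"
    using order_trans[OF abs_ge_zero source[of "T + 1" "(r\<^sub>1 (T + 1) + r\<^sub>2 (T + 1)) / 2"]] lt[of "T + 1"] by auto
  have grow: "\<forall>\<^sub>F \<theta> in at_top. \<forall>r\<in>{r\<^sub>1 \<theta>..r\<^sub>2 \<theta>}. \<bar>u (polar r \<theta>)\<bar> \<le> \<epsilon> * exp (\<nu> * \<theta>)" if "0 < \<epsilon>" for \<epsilon>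
  proof -
    have "\<forall>\<^sub>F \<theta> in at_top. ereal (exp (- \<nu> * \<theta>)) * (SUP x\<in>slice \<theta>. ereal \<bar>u x\<bar>) < ereal \<epsilon>"
      using growth \<nu>_pos that unfolding below_exp_growth_def by (intro order_tendstoD(2)) auto
    then show ?thesis
    proof eventually_elim
      case (elim \<theta>)
      show ?case
      proof
        fix r assume "r \<in> {r\<^sub>1 \<theta>..r\<^sub>2 \<theta>}"
        then have "polar r \<theta> \<in> slice \<theta>" by (auto simp: cross_section_def)
        then have "ereal \<bar>u (polar r \<theta>)\<bar> \<le> (SUP x\<in>slice \<theta>. ereal \<bar>u x\<bar>)" by (rule SUP_upper)
        then have "ereal (exp (- \<nu> * \<theta>)) * ereal \<bar>u (polar r \<theta>)\<bar>
            \<le> ereal (exp (- \<nu> * \<theta>)) * (SUP x\<in>slice \<theta>. ereal \<bar>u x\<bar>)"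
          by (intro ereal_mult_left_mono) auto
        also note elim
        finally have "exp (- \<nu> * \<theta>) * \<bar>u (polar r \<theta>)\<bar> \<le> \<epsilon>" by simp
        then have "exp (\<nu> * \<theta>) * (exp (- \<nu> * \<theta>) * \<bar>u (polar r \<theta>)\<bar>) \<le> exp (\<nu> * \<theta>) * \<epsilon>"
          by (intro mult_left_mono) auto
        then show "\<bar>u (polar r \<theta>)\<bar> \<le> \<epsilon> * exp (\<nu> * \<theta>)"
          by (simp add: mult.commute flip: exp_add mult.assoc)
      qed
    qed
  qed
  have one_sided: "\<sigma> * u (polar r \<theta>) \<le> m\<^sub>B + K / \<kappa> * m\<^sub>f + K * m\<^sub>T * exp (- \<nu> * (\<theta> - T))"
    if \<sigma>: "\<And>y. \<sigma> * y \<le> \<bar>y\<bar>" and r: "r\<^sub>1 \<theta> \<le> r" "r \<le> r\<^sub>2 \<theta>" for \<sigma> r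
  proof (rule comparison[OF C2 cont T m0(1) m1 m0(2) _ _ _ _ _ \<theta> r])
    show "\<sigma> * u (polar (r\<^sub>1 \<alpha>) \<alpha>) \<le> m\<^sub>B" "\<sigma> * u (polar (r\<^sub>2 \<alpha>) \<alpha>) \<le> m\<^sub>B" if "T \<le> \<alpha>" for \<alpha>
      using order_trans[OF \<sigma> sides(1)[OF that]] order_trans[OF \<sigma> sides(2)[OF that]] by auto
    show "\<sigma> * u (polar s T) \<le> m\<^sub>T" if "r\<^sub>1 T \<le> s" "s \<le> r\<^sub>2 T" for s
      using order_trans[OF \<sigma> start[OF that]] .
    show "\<sigma> * nondiv_op A b u (polar s \<alpha>) \<le> m\<^sub>f" if "T < \<alpha>" "r\<^sub>1 \<alpha> < s" "s < r\<^sub>2 \<alpha>" for \<alpha> s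
      using order_trans[OF \<sigma> source[OF that]] .
    show "\<forall>\<^sub>F \<theta> in at_top. \<forall>r\<in>{r\<^sub>1 \<theta>..r\<^sub>2 \<theta>}. \<sigma> * u (polar r \<theta>) \<le> \<epsilon> * exp (\<nu> * \<theta>)" if "0 < \<epsilon>" for \<epsilon>
      using grow[OF that] by eventually_elim (blast intro: order_trans[OF \<sigma>])
  qed
  show ?thesis unfolding sup_abs_def
  proof (rule cSUP_least)
    show "slice \<theta> \<noteq> {}" using lt[OF \<theta>] by (auto simp: cross_section_def intro!: exI[of _ "r\<^sub>1 \<theta>"])
    fix x assume "x \<in> slice \<theta>"
    then obtain r where r: "x = polar r \<theta>" "r\<^sub>1 \<theta> \<le> r" "r \<le> r\<^sub>2 \<theta>" by (auto simp: cross_section_def)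
    show "\<bar>u x\<bar> \<le> m\<^sub>B + K / \<kappa> * m\<^sub>f + K * m\<^sub>T * exp (- \<nu> * (\<theta> - T))"
      using one_sided[of 1 r] one_sided[of "-1" r] r by (auto simp: abs_le_iff)
  qed
qed

end

section \<open>The decay estimate and the asymptotic estimate\<close>

lemma abs_le_sup_abs:
  assumes "bounded (g ` S)" "x \<in> S"
  shows "\<bar>g x\<bar> \<le> sup_abs g S"
proof -
  obtain B where "\<And>y. y \<in> S \<Longrightarrow> \<bar>g y\<bar> \<le> B"
    using assms(1) by (auto simp: bounded_real)
  then have "bdd_above ((\<lambda>x. \<bar>g x\<bar>) ` S)" by (auto intro!: bdd_aboveI[of _ B])
  then show ?thesis unfolding sup_abs_def using assms(2) by (rule cSUP_upper[rotated])
qed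

lemma sup_abs_mono:
  assumes "bounded (g ` S)" "T \<subseteq> S" "T \<noteq> {}"
  shows "0 \<le> sup_abs g T" "sup_abs g T \<le> sup_abs g S"
proof -
  show "sup_abs g T \<le> sup_abs g S"
    unfolding sup_abs_def[of g T] using assms by (intro cSUP_least abs_le_sup_abs) auto
  obtain x where "x \<in> T" using assms by auto
  have "bounded (g ` T)" using assms by (meson bounded_subset image_mono)
  then show "0 \<le> sup_abs g T" using abs_le_sup_abs[OF _ \<open>x \<in> T\<close>, of g] by force
qed

text \<open>Turns the extended-real upper limits of the data into real numbers that can be approximated from
  above.\<close>

lemma real_Limsup_of_bounded:
  fixes g :: "real \<Rightarrow> real"
  assumes "\<forall>\<^sub>F \<theta> in at_top. 0 \<le> g \<theta> \<and> g \<theta> \<le> B"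
  obtains l where "Limsup at_top (\<lambda>\<theta>. ereal (g \<theta>)) = ereal l" "0 \<le> l"
    "\<And>\<delta>. 0 < \<delta> \<Longrightarrow> \<forall>\<^sub>F \<theta> in at_top. g \<theta> \<le> l + \<delta>"
proof -
  let ?L = "Limsup at_top (\<lambda>\<theta>. ereal (g \<theta>))"
  have "?L \<le> ereal B" by (rule Limsup_bounded) (use assms in \<open>auto elim: eventually_mono\<close>)
  moreover have "0 \<le> ?L"
    by (rule le_Limsup) (use assms in \<open>auto elim: eventually_mono\<close>)
  ultimately obtain l where l: "?L = ereal l" "0 \<le> l"
    by (cases ?L) auto
  show thesis
  proof (rule that[OF l])
    fix \<delta> :: real assume "0 < \<delta>"
    then have "?L < ereal (l + \<delta>)" by (simp add: l)
    then have "\<forall>\<^sub>F \<theta> in at_top. ereal (g \<theta>) < ereal (l + \<delta>)" by (rule Limsup_lessD)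
    then show "\<forall>\<^sub>F \<theta> in at_top. g \<theta> \<le> l + \<delta>" by (rule eventually_mono) simp
  qed
qed

context elliptic_spiral_barrier
begin

lemma slice_start_bounded:
  assumes "continuous_on U_closed u" "\<theta>\<^sub>0 \<le> T"
  shows "bounded (u ` slice T)"
proof -
  have "slice T = (\<lambda>z. polar (fst z) (snd z)) ` ({r\<^sub>1 T..r\<^sub>2 T} \<times> {T})"
    unfolding cross_section_def by force
  then have "compact (slice T)"
    by (simp add: compact_continuous_image[OF continuous_on_polar] compact_Times)
  moreover have "slice T \<subseteq> U_closed"
    using assms(2) by (auto simp: cross_section_def spiral_full_def)
  ultimately show ?thesis
    by (metis assms(1) compact_continuous_image compact_imp_bounded continuous_on_subset)
qed

lemma sides_in_curves:
  assumes "\<theta>\<^sub>0 \<le> \<theta>"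
  shows "polar (r\<^sub>1 \<theta>) \<theta> \<in> \<gamma> \<inter> slice \<theta>" "polar (r\<^sub>2 \<theta>) \<theta> \<in> \<gamma> \<inter> slice \<theta>"
  using r1_less_r2[OF assms] assms unfolding spiral_curves_def cross_section_def
  by (auto intro: less_imp_le)

lemma interior_in_slice:
  assumes "\<theta>\<^sub>0 < \<theta>" "r\<^sub>1 \<theta> < r" "r < r\<^sub>2 \<theta>"
  shows "polar r \<theta> \<in> U \<inter> slice \<theta>"
  using assms unfolding spiral_interior_def cross_section_def by force

context
  fixes f u :: "real^2 \<Rightarrow> real"
  assumes f_bounded: "bounded (f ` U)" and C2: "C2_on U u" and cont: "continuous_on U_closed u"
    and sides_bounded: "bounded (u ` \<gamma>)" and growth: "below_exp_growth r\<^sub>1 r\<^sub>2 u"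
    and equation: "\<And>x. x \<in> U \<Longrightarrow> nondiv_op A b u x = f x"
begin

lemma exponential_decay:
  assumes "\<theta>\<^sub>0 \<le> \<theta>"
  shows "sup_abs u (slice \<theta>) \<le> sup_abs u \<gamma> + K / \<kappa> * sup_abs f U
     + K * (sup_abs u (slice \<theta>\<^sub>0) + sup_abs u \<gamma> + K / \<kappa> * sup_abs f U) * exp (- \<nu> * (\<theta> - \<theta>\<^sub>0))"
proof -
  have eq: "nondiv_op A b u (polar r \<alpha>) = f (polar r \<alpha>)" "polar r \<alpha> \<in> U"
    if "\<theta>\<^sub>0 < \<alpha>" "r\<^sub>1 \<alpha> < r" "r < r\<^sub>2 \<alpha>" for r \<alpha>
    using equation interior_in_slice[OF that] by auto
  have "sup_abs u (slice \<theta>) \<le> sup_abs u \<gamma> + K / \<kappa> * sup_abs f U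
     + K * sup_abs u (slice \<theta>\<^sub>0) * exp (- \<nu> * (\<theta> - \<theta>\<^sub>0))"
  proof (rule slice_estimate[OF C2 cont order_refl growth _ _ _ _ assms])
    show "\<bar>u (polar (r\<^sub>1 \<alpha>) \<alpha>)\<bar> \<le> sup_abs u \<gamma>" "\<bar>u (polar (r\<^sub>2 \<alpha>) \<alpha>)\<bar> \<le> sup_abs u \<gamma>"
      if "\<theta>\<^sub>0 \<le> \<alpha>" for \<alpha>
      using sides_in_curves[OF that] by (auto intro!: abs_le_sup_abs sides_bounded)
    show "\<bar>u (polar r \<theta>\<^sub>0)\<bar> \<le> sup_abs u (slice \<theta>\<^sub>0)" if "r\<^sub>1 \<theta>\<^sub>0 \<le> r" "r \<le> r\<^sub>2 \<theta>\<^sub>0" for r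
      using that by (intro abs_le_sup_abs slice_start_bounded cont) (auto simp: cross_section_def)
    show "\<bar>nondiv_op A b u (polar r \<alpha>)\<bar> \<le> sup_abs f U"
      if "\<theta>\<^sub>0 < \<alpha>" "r\<^sub>1 \<alpha> < r" "r < r\<^sub>2 \<alpha>" for r \<alpha>
      using eq[OF that] by (auto intro!: abs_le_sup_abs f_bounded)
  qed
  also have "K * sup_abs u (slice \<theta>\<^sub>0) \<le> K * (sup_abs u (slice \<theta>\<^sub>0) + sup_abs u \<gamma> + K / \<kappa> * sup_abs f U)"
  proof -
    have "\<gamma> \<noteq> {}" using sides_in_curves[of \<theta>\<^sub>0] by auto
    then have "0 \<le> sup_abs u \<gamma>" using sup_abs_mono(1)[OF sides_bounded] by simp
    moreover have "U \<noteq> {}"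
      using interior_in_slice[of "\<theta>\<^sub>0 + 1" "(r\<^sub>1 (\<theta>\<^sub>0 + 1) + r\<^sub>2 (\<theta>\<^sub>0 + 1)) / 2"] r1_less_r2[of "\<theta>\<^sub>0 + 1"] by auto
    then have "0 \<le> sup_abs f U" using sup_abs_mono(1)[OF f_bounded] by simp
    ultimately show ?thesis using K_pos \<kappa>_pos by (intro mult_left_mono) auto
  qed
  finally show ?thesis by (simp add: mult_right_mono)
qed

text \<open>Beyond a large angle \<open>T\<close> the data exceed their upper limits \<open>l\<^sub>B\<close>, \<open>l\<^sub>f\<close> by at most \<open>\<delta>\<close>. The estimate
  restarted at \<open>T\<close> then bounds \<open>u\<close> by \<open>l\<^sub>B + \<delta> + (K / \<kappa>) (l\<^sub>f + \<delta>)\<close> plus a term that decays, however large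
  \<open>u\<close> is on the slice at \<open>T\<close>.\<close>

lemma Limsup_slice_le:
  "Limsup at_top (\<lambda>\<theta>. ereal (sup_abs u (slice \<theta>)))
     \<le> Limsup at_top (\<lambda>\<theta>. ereal (sup_abs u (\<gamma> \<inter> slice \<theta>)))
       + ereal (K / \<kappa>) * Limsup at_top (\<lambda>\<theta>. ereal (sup_abs f (U \<inter> slice \<theta>)))"
proof -
  have "\<forall>\<^sub>F \<theta> in at_top. 0 \<le> sup_abs u (\<gamma> \<inter> slice \<theta>) \<and> sup_abs u (\<gamma> \<inter> slice \<theta>) \<le> sup_abs u \<gamma>"
    using eventually_ge_at_top[of \<theta>\<^sub>0]
  proof eventually_elim
    case (elim \<theta>)
    then show ?case
      using sup_abs_mono[OF sides_bounded, of "\<gamma> \<inter> slice \<theta>"] sides_in_curves by auto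
  qed
  then obtain l\<^sub>B where B: "Limsup at_top (\<lambda>\<theta>. ereal (sup_abs u (\<gamma> \<inter> slice \<theta>))) = ereal l\<^sub>B" "0 \<le> l\<^sub>B"
    "\<And>\<delta>. 0 < \<delta> \<Longrightarrow> \<forall>\<^sub>F \<theta> in at_top. sup_abs u (\<gamma> \<inter> slice \<theta>) \<le> l\<^sub>B + \<delta>"
    by (rule real_Limsup_of_bounded) (rule that)
  have "\<forall>\<^sub>F \<theta> in at_top. 0 \<le> sup_abs f (U \<inter> slice \<theta>) \<and> sup_abs f (U \<inter> slice \<theta>) \<le> sup_abs f U"
    using eventually_gt_at_top[of \<theta>\<^sub>0]
  proof eventually_elim
    case (elim \<theta>)
    then show ?case
      using sup_abs_mono[OF f_bounded, of "U \<inter> slice \<theta>"]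
        interior_in_slice[of \<theta> "(r\<^sub>1 \<theta> + r\<^sub>2 \<theta>) / 2"] r1_less_r2[of \<theta>] by auto
  qed
  then obtain l\<^sub>f where F: "Limsup at_top (\<lambda>\<theta>. ereal (sup_abs f (U \<inter> slice \<theta>))) = ereal l\<^sub>f" "0 \<le> l\<^sub>f"
    "\<And>\<delta>. 0 < \<delta> \<Longrightarrow> \<forall>\<^sub>F \<theta> in at_top. sup_abs f (U \<inter> slice \<theta>) \<le> l\<^sub>f + \<delta>"
    by (rule real_Limsup_of_bounded) (rule that)
  have "Limsup at_top (\<lambda>\<theta>. ereal (sup_abs u (slice \<theta>))) \<le> ereal (l\<^sub>B + K / \<kappa> * l\<^sub>f) + ereal e"
    if "e > 0" for e
  proof -
    \<comment> \<open>The three errors are \<open>\<delta>\<close> from the sides, \<open>(K / \<kappa>) \<delta>\<close> from the source and \<open>\<delta>\<close> from the decaying term.\<close>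
    define \<delta> where "\<delta> = e / (2 + K / \<kappa>)"
    have "0 < K / \<kappa>" using K_pos \<kappa>_pos by simp
    then have "0 < \<delta>" and "(2 + K / \<kappa>) * \<delta> = e"
      using \<open>e > 0\<close> by (simp_all add: \<delta>_def add_pos_pos del: times_divide_eq_left)
    moreover have "(2 + K / \<kappa>) * \<delta> = \<delta> + K / \<kappa> * \<delta> + \<delta>" by (simp only: distrib_right mult_2)
    ultimately have \<delta>: "0 < \<delta>" "\<delta> + K / \<kappa> * \<delta> + \<delta> = e" by simp_all
    obtain T where T: "\<And>\<theta>. T \<le> \<theta> \<Longrightarrow> \<theta>\<^sub>0 < \<theta> \<and> sup_abs u (\<gamma> \<inter> slice \<theta>) \<le> l\<^sub>B + \<delta> \<and> sup_abs f (U \<inter> slice \<theta>) \<le> l\<^sub>f + \<delta>"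
      using eventually_conj[OF eventually_gt_at_top[of \<theta>\<^sub>0] eventually_conj[OF B(3)[OF \<delta>(1)] F(3)[OF \<delta>(1)]]]
      by (auto simp: eventually_at_top_linorder)
    define m where "m = sup_abs u (slice T)"
    have est: "sup_abs u (slice \<theta>) \<le> (l\<^sub>B + \<delta>) + K / \<kappa> * (l\<^sub>f + \<delta>) + K * m * exp (- \<nu> * (\<theta> - T))"
      if "T \<le> \<theta>" for \<theta>
    proof (rule slice_estimate[OF C2 cont _ growth _ _ _ _ that])
      show T0: "\<theta>\<^sub>0 \<le> T" using T[of T] by simp
      show "\<bar>u (polar (r\<^sub>1 \<alpha>) \<alpha>)\<bar> \<le> l\<^sub>B + \<delta>" "\<bar>u (polar (r\<^sub>2 \<alpha>) \<alpha>)\<bar> \<le> l\<^sub>B + \<delta>" if "T \<le> \<alpha>" for \<alpha>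
      proof -
        have bd: "bounded (u ` (\<gamma> \<inter> slice \<alpha>))"
          using sides_bounded by (rule bounded_subset) auto
        have "\<theta>\<^sub>0 \<le> \<alpha>" using T0 that by simp
        note s = sides_in_curves[OF this]
        show "\<bar>u (polar (r\<^sub>1 \<alpha>) \<alpha>)\<bar> \<le> l\<^sub>B + \<delta>" "\<bar>u (polar (r\<^sub>2 \<alpha>) \<alpha>)\<bar> \<le> l\<^sub>B + \<delta>"
          using abs_le_sup_abs[OF bd s(1)] abs_le_sup_abs[OF bd s(2)] T[OF that] by linarith+
      qed
      show "\<bar>u (polar r T)\<bar> \<le> m" if "r\<^sub>1 T \<le> r" "r \<le> r\<^sub>2 T" for r
        unfolding m_def using that T0
        by (intro abs_le_sup_abs slice_start_bounded cont) (auto simp: cross_section_def)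
      show "\<bar>nondiv_op A b u (polar r \<alpha>)\<bar> \<le> l\<^sub>f + \<delta>" if "T < \<alpha>" "r\<^sub>1 \<alpha> < r" "r < r\<^sub>2 \<alpha>" for r \<alpha>
      proof -
        have bd: "bounded (f ` (U \<inter> slice \<alpha>))"
          using f_bounded by (rule bounded_subset) auto
        have p: "polar r \<alpha> \<in> U \<inter> slice \<alpha>" using interior_in_slice[OF _ that(2,3)] T0 that by simp
        show ?thesis
          using abs_le_sup_abs[OF bd p] T[of \<alpha>] that equation[of "polar r \<alpha>"] p by simp
      qed
    qed
    have "((\<lambda>\<theta>. K * m * exp (- \<nu> * (\<theta> - T))) \<longlongrightarrow> K * m * 0) at_top"
    proof (intro tendsto_mult tendsto_const)
      have "filterlim (\<lambda>\<theta>. \<nu> * (- T + \<theta>)) at_top at_top"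
        by (rule filterlim_tendsto_pos_mult_at_top[OF tendsto_const \<nu>_pos
              filterlim_tendsto_add_at_top[OF tendsto_const filterlim_ident]])
      then have "filterlim (\<lambda>\<theta>. - \<nu> * (\<theta> - T)) at_bot at_top"
        unfolding filterlim_uminus_at_top by (simp add: algebra_simps)
      then show "((\<lambda>\<theta>. exp (- \<nu> * (\<theta> - T))) \<longlongrightarrow> 0) at_top"
        by (rule filterlim_compose[OF exp_at_bot])
    qed
    then have small: "\<forall>\<^sub>F \<theta> in at_top. K * m * exp (- \<nu> * (\<theta> - T)) < \<delta>"
      using \<delta>(1) by (intro order_tendstoD(2)) auto
    have "\<forall>\<^sub>F \<theta> in at_top. sup_abs u (slice \<theta>) \<le> l\<^sub>B + K / \<kappa> * l\<^sub>f + e"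
      using small eventually_ge_at_top[of T]
    proof eventually_elim
      case (elim \<theta>)
      have "(l\<^sub>B + \<delta>) + K / \<kappa> * (l\<^sub>f + \<delta>) + \<delta> = l\<^sub>B + K / \<kappa> * l\<^sub>f + e"
        unfolding \<delta>(2)[symmetric] distrib_left by simp
      then show ?case using est[OF elim(2)] elim(1) by linarith
    qed
    then have "Limsup at_top (\<lambda>\<theta>. ereal (sup_abs u (slice \<theta>))) \<le> ereal (l\<^sub>B + K / \<kappa> * l\<^sub>f + e)"
      by (intro Limsup_bounded) (auto elim: eventually_mono)
    then show ?thesis by simp
  qed
  then have "Limsup at_top (\<lambda>\<theta>. ereal (sup_abs u (slice \<theta>))) \<le> ereal (l\<^sub>B + K / \<kappa> * l\<^sub>f)"
    by (rule ereal_le_epsilon2)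
  then show ?thesis unfolding B(1) F(1) by simp
qed

end

end

theorem theorem5p3:
  fixes \<theta>\<^sub>0 r_star c\<^sub>0 M\<^sub>1 M\<^sub>2 :: real
    and r\<^sub>1 r\<^sub>2 :: "real \<Rightarrow> real"
    and A :: "real^2 \<Rightarrow> real^2^2"
    and b :: "real^2 \<Rightarrow> real^2"
  assumes "continuous_on {\<theta>\<^sub>0..} r\<^sub>1" and "continuous_on {\<theta>\<^sub>0..} r\<^sub>2"
    and "\<And>\<theta>. \<theta> \<ge> \<theta>\<^sub>0 \<Longrightarrow> 0 < r\<^sub>1 \<theta>" and "\<And>\<theta>. \<theta> \<ge> \<theta>\<^sub>0 \<Longrightarrow> 0 < r\<^sub>2 \<theta>"
    and "\<And>\<theta>. \<theta> \<ge> \<theta>\<^sub>0 \<Longrightarrow> r\<^sub>2 (\<theta> + 2 * pi) < r\<^sub>1 \<theta> \<and> r\<^sub>1 \<theta> < r\<^sub>2 \<theta>"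
    and "0 < r_star"
    and "(r\<^sub>1 \<longlongrightarrow> r_star) at_top" and "(r\<^sub>2 \<longlongrightarrow> r_star) at_top"
    and "\<And>x. x \<in> spiral_interior \<theta>\<^sub>0 r\<^sub>1 r\<^sub>2 \<Longrightarrow> transpose (A x) = A x"
    and "0 < c\<^sub>0" and "0 < M\<^sub>1"
    and "\<And>x \<xi>. x \<in> spiral_interior \<theta>\<^sub>0 r\<^sub>1 r\<^sub>2 \<Longrightarrow> \<xi> \<bullet> (A x *v \<xi>) \<ge> c\<^sub>0 * (norm \<xi>)\<^sup>2"
    and "\<And>x. x \<in> spiral_interior \<theta>\<^sub>0 r\<^sub>1 r\<^sub>2 \<Longrightarrow> trace (A x) \<le> M\<^sub>1"
    and "0 \<le> M\<^sub>2"
    and "\<And>x. x \<in> spiral_interior \<theta>\<^sub>0 r\<^sub>1 r\<^sub>2 \<Longrightarrow> norm (b x) \<le> M\<^sub>2"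
  shows "\<exists>C_star \<nu> K\<^sub>1 :: real. C_star > 0 \<and> \<nu> > 0 \<and> K\<^sub>1 > 0 \<and>
    (\<forall>(f :: real^2 \<Rightarrow> real) (u :: real^2 \<Rightarrow> real).
      bounded (f ` spiral_interior \<theta>\<^sub>0 r\<^sub>1 r\<^sub>2) \<and>
      C2_on (spiral_interior \<theta>\<^sub>0 r\<^sub>1 r\<^sub>2) u \<and>
      continuous_on (spiral_full \<theta>\<^sub>0 r\<^sub>1 r\<^sub>2) u \<and>
      bounded (u ` spiral_curves \<theta>\<^sub>0 r\<^sub>1 r\<^sub>2) \<and>
      below_exp_growth r\<^sub>1 r\<^sub>2 u \<and>
      (\<forall>x\<in>spiral_interior \<theta>\<^sub>0 r\<^sub>1 r\<^sub>2. nondiv_op A b u x = f x)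
      \<longrightarrow>
      (\<forall>\<theta>\<ge>\<theta>\<^sub>0.
        sup_abs u (cross_section r\<^sub>1 r\<^sub>2 \<theta>)
        \<le> sup_abs u (spiral_curves \<theta>\<^sub>0 r\<^sub>1 r\<^sub>2) + K\<^sub>1 * sup_abs f (spiral_interior \<theta>\<^sub>0 r\<^sub>1 r\<^sub>2)
          + C_star * (sup_abs u (cross_section r\<^sub>1 r\<^sub>2 \<theta>\<^sub>0)
                      + sup_abs u (spiral_curves \<theta>\<^sub>0 r\<^sub>1 r\<^sub>2)
                      + K\<^sub>1 * sup_abs f (spiral_interior \<theta>\<^sub>0 r\<^sub>1 r\<^sub>2))
            * exp (- \<nu> * (\<theta> - \<theta>\<^sub>0)))
      \<and>
      Limsup at_top (\<lambda>\<theta>. ereal (sup_abs u (cross_section r\<^sub>1 r\<^sub>2 \<theta>)))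
        \<le> Limsup at_top (\<lambda>\<theta>. ereal (sup_abs u (spiral_curves \<theta>\<^sub>0 r\<^sub>1 r\<^sub>2 \<inter> cross_section r\<^sub>1 r\<^sub>2 \<theta>)))
          + ereal K\<^sub>1 *
            Limsup at_top (\<lambda>\<theta>. ereal (sup_abs f (spiral_interior \<theta>\<^sub>0 r\<^sub>1 r\<^sub>2 \<inter> cross_section r\<^sub>1 r\<^sub>2 \<theta>))))"
proof -
  interpret elliptic_spiral \<theta>\<^sub>0 r_star r\<^sub>1 r\<^sub>2 c\<^sub>0 M\<^sub>1 M\<^sub>2 A b
    by unfold_locales (use assms in auto)
  obtain R where R: "\<And>\<theta>. \<theta> \<ge> \<theta>\<^sub>0 \<Longrightarrow> r\<^sub>2 \<theta> \<le> R" using r2_bounded by blast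
  obtain K \<mu> \<nu> \<kappa> where "elliptic_spiral_barrier \<theta>\<^sub>0 r_star r\<^sub>1 r\<^sub>2 c\<^sub>0 M\<^sub>1 M\<^sub>2 A b K \<mu> \<nu> \<kappa> R"
  proof (rule barrier_supersolution[OF \<open>0 < c\<^sub>0\<close> \<open>0 < M\<^sub>1\<close> \<open>0 \<le> M\<^sub>2\<close> \<open>0 < r_star\<close>, of R])
    fix \<mu> \<nu> \<kappa> K :: real
    assume *: "0 < \<nu>" "0 < \<kappa>"
      "\<And>r \<theta>. 0 \<le> r \<Longrightarrow> r \<le> R \<Longrightarrow> 1 \<le> K - exp (\<mu> * (r * cos \<theta>))"
      "\<And>r \<theta> s \<xi> \<eta> \<beta>. r_star \<le> r \<Longrightarrow> r \<le> R \<Longrightarrow> \<bar>s\<bar> \<le> \<nu> \<Longrightarrow>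
           (\<xi> $ 1)\<^sup>2 + (\<eta> $ 1)\<^sup>2 \<ge> c\<^sub>0 \<Longrightarrow> (norm \<xi>)\<^sup>2 + (norm \<eta>)\<^sup>2 \<le> M\<^sub>1 \<Longrightarrow> norm \<beta> \<le> M\<^sub>2 \<Longrightarrow>
           \<kappa> * exp (s * \<theta>) \<le> - (barrier_curvature K \<mu> s r \<theta> \<xi> + barrier_curvature K \<mu> s r \<theta> \<eta>)
                             + barrier_slope K \<mu> s r \<theta> \<beta> 0"
    have "elliptic_spiral_barrier \<theta>\<^sub>0 r_star r\<^sub>1 r\<^sub>2 c\<^sub>0 M\<^sub>1 M\<^sub>2 A b K \<mu> \<nu> \<kappa> R"
      by unfold_locales (fact * R)+
    then show thesis by (rule that)
  qed
  then interpret elliptic_spiral_barrier \<theta>\<^sub>0 r_star r\<^sub>1 r\<^sub>2 c\<^sub>0 M\<^sub>1 M\<^sub>2 A b K \<mu> \<nu> \<kappa> R .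
  show ?thesis
    using K_pos \<nu>_pos \<kappa>_pos exponential_decay Limsup_slice_le
    by (intro exI[of _ K] exI[of _ \<nu>] exI[of _ "K / \<kappa>"] conjI allI impI) (auto simp del: times_divide_eq_left)
qed

end
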